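(* Let $H=(V,E,w)$ be a directed hypergraph on $n$ vertices with hyperedge weights $w:E\to\mathbb{R}_+$ and vertex weights $\pi:V\to\mathbb{R}_+$. Then $$\lambda^{\Delta}_\pi(H)\lesssim\vec\phi_\pi(H)\lesssim\sqrt{\log n}\cdot\lambda^{\Delta}_\pi(H).$$
   Context: Each hyperedge is $e=(H_e,T_e)$ with $H_e,T_e\subseteq V$ (head and tail sets). For $S\subseteq V$, $\delta^+(S)=\{e\in E:T_e\cap S\ne\emptyset,\ H_e\cap\overline S\ne\emptyset\}$, $\vec\phi_\pi(S)=\frac{\min\{w(\delta^+(S)),w(\delta^+(\overline S))\}}{\min\{\pi(S),\pi(\overline S)\}}$, $\vec\phi_\pi(H)=\min_{\emptyset\ne S\subsetneq V}\vec\phi_\pi(S)$. Let $\mathcal F(H)$ be the set of $F:V\times V\to\mathbb{R}_{\ge0}$ for which there are $F_e:H_e\times T_e\to\mathbb{R}_{\ge0}$ ($e\in E$) with $F(i,j)=\sum_{e:i\in H_e,j\in T_e}F_e(i,j)$, $\sum_{i\in H_e,j\in T_e}F_e(i,j)\le w(e)$ for all $e$, and $\sum_{i\in V}F(i,j)=\sum_{k\in V}F(j,k)$ for all $j$. Define $\lambda^{\Delta}_\pi(H)$ as the minimum over $v_1,\dots,v_n\in\mathbb{R}^n$ with $\sum_i\pi(i)v_i=0$, $\sum_i\pi(i)\|v_i\|^2=1$, $\|v_i-v_j\|^2+\|v_j-v_k\|^2\ge\|v_i-v_k\|^2$ for all $i,j,k$, of $\max_{F\in\mathcal F(H)}\sum_{i<j}\frac12(F(i,j)+F(j,i))\|v_i-v_j\|^2$.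 $\lesssim$ hides an absolute constant. *)

theory Defs
  imports Complex_Main
begin

text \<open>Directed hypergraph on vertex set V = {..<n}; hyperedges indexed by a finite
  set E of naturals, with head sets Hd e, tail sets Tl e and weights w e.
  Vertex weights vw.\<close>

definition dhg_wf :: "nat \<Rightarrow> nat set \<Rightarrow> (nat \<Rightarrow> nat set) \<Rightarrow> (nat \<Rightarrow> nat set)
    \<Rightarrow> (nat \<Rightarrow> real) \<Rightarrow> (nat \<Rightarrow> real) \<Rightarrow> bool" where
  "dhg_wf n E Hd Tl w vw \<longleftrightarrow> finite E \<and> (\<forall>e\<in>E. Hd e \<subseteq> {..<n} \<and> Tl e \<subseteq> {..<n} \<and> w e > 0)
     \<and> (\<forall>i<n. vw i > 0)"

definition delta_out :: "nat \<Rightarrow> nat set \<Rightarrow> (nat \<Rightarrow> nat set) \<Rightarrow> (nat \<Rightarrow> nat set) \<Rightarrow> nat set \<Rightarrow> nat set" where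
  "delta_out n E Hd Tl S = {e \<in> E. Tl e \<inter> S \<noteq> {} \<and> Hd e \<inter> ({..<n} - S) \<noteq> {}}"

definition dir_expansion_set :: "nat \<Rightarrow> nat set \<Rightarrow> (nat \<Rightarrow> nat set) \<Rightarrow> (nat \<Rightarrow> nat set)
    \<Rightarrow> (nat \<Rightarrow> real) \<Rightarrow> (nat \<Rightarrow> real) \<Rightarrow> nat set \<Rightarrow> real" where
  "dir_expansion_set n E Hd Tl w vw S =
     min (sum w (delta_out n E Hd Tl S)) (sum w (delta_out n E Hd Tl ({..<n} - S)))
     / min (sum vw S) (sum vw ({..<n} - S))"

definition dir_expansion :: "nat \<Rightarrow> nat set \<Rightarrow> (nat \<Rightarrow> nat set) \<Rightarrow> (nat \<Rightarrow> nat set)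
    \<Rightarrow> (nat \<Rightarrow> real) \<Rightarrow> (nat \<Rightarrow> real) \<Rightarrow> real" where
  "dir_expansion n E Hd Tl w vw =
     Min ((\<lambda>S. dir_expansion_set n E Hd Tl w vw S) ` {S. S \<noteq> {} \<and> S \<subset> {..<n}})"

definition flows :: "nat \<Rightarrow> nat set \<Rightarrow> (nat \<Rightarrow> nat set) \<Rightarrow> (nat \<Rightarrow> nat set)
    \<Rightarrow> (nat \<Rightarrow> real) \<Rightarrow> (nat \<Rightarrow> nat \<Rightarrow> real) set" where
  "flows n E Hd Tl w = {F. \<exists>Fe :: nat \<Rightarrow> nat \<Rightarrow> nat \<Rightarrow> real.
      (\<forall>e\<in>E. \<forall>i\<in>Hd e. \<forall>j\<in>Tl e. Fe e i j \<ge> 0)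
    \<and> (\<forall>e\<in>E. (\<Sum>i\<in>Hd e. \<Sum>j\<in>Tl e. Fe e i j) \<le> w e)
    \<and> F = (\<lambda>i j. \<Sum>e\<in>{e\<in>E. i \<in> Hd e \<and> j \<in> Tl e}. Fe e i j)
    \<and> (\<forall>j<n. (\<Sum>i<n. F i j) = (\<Sum>k<n. F j k))}"

definition sqdist :: "nat \<Rightarrow> (nat \<Rightarrow> real) \<Rightarrow> (nat \<Rightarrow> real) \<Rightarrow> real" where
  "sqdist n x y = (\<Sum>k<n. (x k - y k)^2)"

definition sdp_feasible :: "nat \<Rightarrow> (nat \<Rightarrow> real) \<Rightarrow> (nat \<Rightarrow> nat \<Rightarrow> real) \<Rightarrow> bool" where
  "sdp_feasible n vw v \<longleftrightarrow>
     (\<forall>k<n. (\<Sum>i<n. vw i * v i k) = 0)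
   \<and> (\<Sum>i<n. vw i * (\<Sum>k<n. (v i k)^2)) = 1
   \<and> (\<forall>i<n. \<forall>j<n. \<forall>k<n. sqdist n (v i) (v j) + sqdist n (v j) (v k) \<ge> sqdist n (v i) (v k))"

definition sdp_objective :: "nat \<Rightarrow> (nat \<Rightarrow> nat \<Rightarrow> real) \<Rightarrow> (nat \<Rightarrow> nat \<Rightarrow> real) \<Rightarrow> real" where
  "sdp_objective n F v = (\<Sum>j<n. \<Sum>i<j. (F i j + F j i) / 2 * sqdist n (v i) (v j))"

definition lambda_tri :: "nat \<Rightarrow> nat set \<Rightarrow> (nat \<Rightarrow> nat set) \<Rightarrow> (nat \<Rightarrow> nat set)
    \<Rightarrow> (nat \<Rightarrow> real) \<Rightarrow> (nat \<Rightarrow> real) \<Rightarrow> real" where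
  "lambda_tri n E Hd Tl w vw =
     (INF v\<in>{v. sdp_feasible n vw v}. (SUP F\<in>flows n E Hd Tl w. sdp_objective n F v))"

end

theory Submission
  imports Defs "HOL-Analysis.Bochner_Integration" "HOL-Analysis.Lebesgue_Measure"
begin

text \<open>Lower bound on the expansion: a cut \<open>S\<close> yields two-valued vectors, and a circulation crosses \<open>S\<close>
  equally in both directions, so its flow is bounded by the smaller of the two boundaries.

  Upper bound: by linear programming duality, the optimal flow value for fixed vectors is
  \<open>\<Sum> w(e) q(e)\<close> for some potential \<open>\<rho>\<close> with \<open>\<parallel>v\<^sub>i - v\<^sub>j\<parallel>\<^sup>2/2 + \<rho>\<^sub>j - \<rho>\<^sub>i \<le> q(e)\<close> for
  heads \<open>i\<close> and tails \<open>j\<close> of \<open>e\<close>; the left-hand side is a directed quasimetric. The distance to a suitable heavy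
  set \<open>Z\<close> in this quasimetric is a function whose level sets are the candidate cuts. The set \<open>Z\<close>
  is half (cut at the median of \<open>\<rho>\<close>) of a set \<open>U\<close> that is either a heavy ball or one of two
  Arora-Rao-Vazirani separated sets. Separated sets exist by Rothvoss's chaining argument, here with random
  signs in place of Gaussians: if for a typical direction no well-separated pair of sets existed, there
  would be a large matching of close vertices with well-separated projections, and following these
  matchings would make the expected maximal projection of a difference grow linearly in the number of
  steps (using only a variance bound), beyond what the union bound over \<open>n\<close> vertices allows.\<close>

section \<open>Random signs\<close>

text \<open>Signs suffice because the argument uses the random direction only through finite
  averages: the variance of a maximum, exponential and fourth moments, and invariance under
  negation. The directed obstacle is the uncontrolled potential \<open>\<rho>\<close>: sets that are
  far apart in the metric may be close in the quasimetric, which can even be negative. The median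
  cut gives \<open>\<rho>\<^sub>j - \<rho>\<^sub>i\<close> a favourable sign at the cost of constant
  factors. It does not let one choose the orientation, but the expansion takes the smaller of the
  two boundaries of a cut, so level sets serve in either direction. The root of \<open>ln n\<close>
  comes from balancing the chain. About \<open>sqrt (ln n)\<close> steps of squared length about
  \<open>1 / (W * sqrt (ln n))\<close> are made, \<open>W\<close> being the total vertex weight.
  Squared distances add up by the triangle inequality, so the chain ends at squared distance of
  order \<open>1 / W\<close>. There the deviation of a maximum is still a small part of the gain per
  step, of order \<open>1 / sqrt W\<close>, while the accumulated gain already exceeds the union
  bound.\<close>

definition cube_avg :: "'a set \<Rightarrow> ('a set \<Rightarrow> real) \<Rightarrow> real" where
  "cube_avg I f = (\<Sum>A\<in>Pow I. f A) / 2 ^ card I"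

text \<open>The subset \<open>A\<close> encodes the sign vector that is \<open>+1\<close> on
  \<open>A\<close> and \<open>-1\<close> elsewhere, so \<open>cube_avg\<close> is the expectation
  under independent fair signs and complementation is negation of the direction.\<close>

definition rad :: "'a set \<Rightarrow> ('a \<Rightarrow> real) \<Rightarrow> 'a set \<Rightarrow> real" where
  "rad I x A = (\<Sum>k\<in>I. if k \<in> A then x k else - x k)"

lemma cube_avg_empty [simp]: "cube_avg {} f = f {}"
  by (simp add: cube_avg_def)

lemma cube_avg_insert:
  assumes "finite I" "x \<notin> I"
  shows "cube_avg (insert x I) f = (cube_avg I f + cube_avg I (\<lambda>A. f (insert x A))) / 2"
proof -
  have inj: "inj_on (insert x) (Pow I)"
    using assms(2) by (intro inj_onI) (metis Diff_insert_absorb PowD subsetD)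
  have "(\<Sum>A\<in>Pow (insert x I). f A) = (\<Sum>A\<in>Pow I. f A) + (\<Sum>A\<in>insert x ` Pow I. f A)"
    unfolding Pow_insert using assms by (intro sum.union_disjoint) auto
  also have "(\<Sum>A\<in>insert x ` Pow I. f A) = (\<Sum>A\<in>Pow I. f (insert x A))"
    by (simp add: sum.reindex[OF inj])
  finally show ?thesis
    using assms by (simp add: cube_avg_def field_simps)
qed

lemma cube_avg_cong: "(\<And>A. A \<subseteq> I \<Longrightarrow> f A = g A) \<Longrightarrow> cube_avg I f = cube_avg I g"
  unfolding cube_avg_def by (intro arg_cong2[where f = "(/)"] sum.cong) auto

lemma cube_avg_add: "cube_avg I (\<lambda>A. f A + g A) = cube_avg I f + cube_avg I g"
  by (simp add: cube_avg_def sum.distrib add_divide_distrib)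

lemma cube_avg_diff: "cube_avg I (\<lambda>A. f A - g A) = cube_avg I f - cube_avg I g"
  by (simp add: cube_avg_def sum_subtractf diff_divide_distrib)

lemma cube_avg_mult: "cube_avg I (\<lambda>A. c * f A) = c * cube_avg I f"
  by (simp add: cube_avg_def sum_distrib_left)

lemma cube_avg_mult_right: "cube_avg I (\<lambda>A. f A * c) = cube_avg I f * c"
  using cube_avg_mult[of I c f] by (simp add: mult.commute)

lemma cube_avg_sum: "cube_avg I (\<lambda>A. \<Sum>j\<in>J. f j A) = (\<Sum>j\<in>J. cube_avg I (f j))"
  unfolding cube_avg_def by (subst sum.swap) (simp add: sum_divide_distrib)

lemma cube_avg_const [simp]: "finite I \<Longrightarrow> cube_avg I (\<lambda>A. c) = c"
  by (simp add: cube_avg_def card_Pow)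

lemma cube_avg_mono: "(\<And>A. A \<subseteq> I \<Longrightarrow> f A \<le> g A) \<Longrightarrow> cube_avg I f \<le> cube_avg I g"
  unfolding cube_avg_def by (intro divide_right_mono sum_mono) auto

lemma cube_avg_compl: "cube_avg I (\<lambda>A. f (I - A)) = cube_avg I f"
proof -
  have "bij_betw (\<lambda>A. I - A) (Pow I) (Pow I)"
    by (rule bij_betw_byWitness[where f' = "\<lambda>A. I - A"]) auto
  then show ?thesis
    unfolding cube_avg_def by (simp add: sum.reindex_bij_betw[of "\<lambda>A. I - A"])
qed

lemma cube_avg_flip:
  assumes "i \<in> I"
  shows "cube_avg I (\<lambda>A. f (sym_diff A {i})) = cube_avg I f"
proof -
  have "bij_betw (\<lambda>A. sym_diff A {i}) (Pow I) (Pow I)"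
    using assms by (intro bij_betw_byWitness[where f' = "\<lambda>A. sym_diff A {i}"]) auto
  then show ?thesis
    unfolding cube_avg_def by (simp add: sum.reindex_bij_betw[of "\<lambda>A. sym_diff A {i}"])
qed

lemma cube_avg_square:
  assumes "finite I"
  shows "cube_avg I (\<lambda>A. (f A - cube_avg I f)\<^sup>2) = cube_avg I (\<lambda>A. (f A)\<^sup>2) - (cube_avg I f)\<^sup>2"
proof -
  have "(\<lambda>A. (f A - cube_avg I f)\<^sup>2)
      = (\<lambda>A. (f A)\<^sup>2 - (2 * cube_avg I f) * f A + (cube_avg I f)\<^sup>2)"
    by (auto simp: power2_eq_square algebra_simps)
  then show ?thesis
    using assms by (simp add: cube_avg_add cube_avg_diff cube_avg_mult) (simp add: power2_eq_square)
qed

lemma cube_avg_jensen_square: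
  assumes "finite I"
  shows "(cube_avg I f)\<^sup>2 \<le> cube_avg I (\<lambda>A. (f A)\<^sup>2)"
proof -
  have "0 \<le> cube_avg I (\<lambda>A. (f A - cube_avg I f)\<^sup>2)"
    using cube_avg_mono[of I "\<lambda>_. 0" "\<lambda>A. (f A - cube_avg I f)\<^sup>2"] assms by simp
  then show ?thesis using cube_avg_square[OF assms, of f] by simp
qed

text \<open>Splitting off one coordinate, the variance is the mean of the two conditional variances
  plus a quarter of the squared difference of the conditional means. By Jensen's inequality that
  last term is at most the energy of the new coordinate, and the induction hypothesis handles both
  halves.\<close>

lemma cube_poincare:
  assumes "finite I"
  shows "cube_avg I (\<lambda>A. (f A)\<^sup>2) - (cube_avg I f)\<^sup>2
         \<le> (\<Sum>i\<in>I. cube_avg I (\<lambda>A. (f A - f (sym_diff A {i}))\<^sup>2)) / 4"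
  using assms
proof (induction I arbitrary: f rule: finite_induct)
  case empty
  then show ?case by simp
next
  case (insert x I)
  let ?g = "\<lambda>A. f (insert x A)"
  let ?D = "\<lambda>J h i. cube_avg J (\<lambda>A. (h A - h (sym_diff A {i}))\<^sup>2)"
  have Dx: "?D (insert x I) f x = cube_avg I (\<lambda>A. (f A - ?g A)\<^sup>2)"
  proof -
    have "cube_avg I (\<lambda>A. (f A - f (sym_diff A {x}))\<^sup>2) = cube_avg I (\<lambda>A. (f A - ?g A)\<^sup>2)"
      using insert.hyps
      by (intro cube_avg_cong arg_cong[where f = "\<lambda>B. (f _ - f B)\<^sup>2"]) auto
    moreover have "cube_avg I (\<lambda>A. (f (insert x A) - f (sym_diff (insert x A) {x}))\<^sup>2)
        = cube_avg I (\<lambda>A. (f A - ?g A)\<^sup>2)"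
    proof (intro cube_avg_cong)
      fix A assume "A \<subseteq> I"
      then have "sym_diff (insert x A) {x} = A" using insert.hyps by auto
      then show "(f (insert x A) - f (sym_diff (insert x A) {x}))\<^sup>2 = (f A - ?g A)\<^sup>2"
        by (simp add: power2_commute)
    qed
    ultimately show ?thesis using insert.hyps by (simp add: cube_avg_insert)
  qed
  have Di: "?D (insert x I) f i = (?D I f i + ?D I ?g i) / 2" if "i \<in> I" for i
  proof -
    have "cube_avg I (\<lambda>A. (f (insert x A) - f (sym_diff (insert x A) {i}))\<^sup>2) = ?D I ?g i"
    proof (intro cube_avg_cong)
      fix A assume "A \<subseteq> I"
      have "sym_diff (insert x A) {i} = insert x (sym_diff A {i})"
        using that insert.hyps by auto
      then show "(f (insert x A) - f (sym_diff (insert x A) {i}))\<^sup>2 = (?g A - ?g (sym_diff A {i}))\<^sup>2"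
        by simp
    qed
    then show ?thesis using insert.hyps by (simp add: cube_avg_insert)
  qed
  have "(cube_avg I f - cube_avg I ?g)\<^sup>2 \<le> cube_avg I (\<lambda>A. (f A - ?g A)\<^sup>2)"
    using cube_avg_jensen_square[OF insert.hyps(1), of "\<lambda>A. f A - ?g A"]
    by (simp add: cube_avg_diff)
  moreover have "cube_avg I (\<lambda>A. (f A)\<^sup>2) - (cube_avg I f)\<^sup>2 \<le> (\<Sum>i\<in>I. ?D I f i) / 4"
    by (rule insert.IH)
  moreover have "cube_avg I (\<lambda>A. (?g A)\<^sup>2) - (cube_avg I ?g)\<^sup>2 \<le> (\<Sum>i\<in>I. ?D I ?g i) / 4"
    by (rule insert.IH)
  moreover have "(\<Sum>i\<in>insert x I. ?D (insert x I) f i)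
      = cube_avg I (\<lambda>A. (f A - ?g A)\<^sup>2) + ((\<Sum>i\<in>I. ?D I f i) + (\<Sum>i\<in>I. ?D I ?g i)) / 2"
  proof -
    have "(\<Sum>i\<in>I. ?D (insert x I) f i) = (\<Sum>i\<in>I. (?D I f i + ?D I ?g i) / 2)"
      by (intro sum.cong refl Di)
    then show ?thesis
      using insert.hyps Dx by (simp add: sum.distrib flip: sum_divide_distrib)
  qed
  moreover have "((cube_avg I f + cube_avg I ?g) / 2)\<^sup>2
      = ((cube_avg I f)\<^sup>2 + (cube_avg I ?g)\<^sup>2) / 2 - (cube_avg I f - cube_avg I ?g)\<^sup>2 / 4"
    by (simp add: power2_eq_square field_simps)
  ultimately show ?case
    unfolding cube_avg_insert[OF insert.hyps(1,2), of f]
      cube_avg_insert[OF insert.hyps(1,2), of "\<lambda>A. (f A)\<^sup>2"] by argo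
qed

section \<open>Moments of a signed sum and maxima of several signed sums\<close>

lemma rad_insert:
  assumes "finite I" "x \<notin> I" "A \<subseteq> I"
  shows "rad (insert x I) a A = rad I a A - a x" "rad (insert x I) a (insert x A) = rad I a A + a x"
proof -
  have "(\<Sum>k\<in>I. if k \<in> insert x A then a k else - a k) = (\<Sum>k\<in>I. if k \<in> A then a k else - a k)"
    using assms by (intro sum.cong) auto
  then show "rad (insert x I) a A = rad I a A - a x" "rad (insert x I) a (insert x A) = rad I a A + a x"
    using assms by (auto simp: rad_def)
qed

lemma cube_avg_rad_insert:
  assumes "finite I" "x \<notin> I"
  shows "cube_avg (insert x I) (\<lambda>A. h (rad (insert x I) a A))
       = cube_avg I (\<lambda>A. (h (rad I a A - a x) + h (rad I a A + a x)) / 2)"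
proof -
  have 1: "cube_avg I (\<lambda>A. h (rad (insert x I) a A)) = cube_avg I (\<lambda>A. h (rad I a A - a x))"
    by (intro cube_avg_cong) (simp add: rad_insert assms)
  have 2: "cube_avg I (\<lambda>A. h (rad (insert x I) a (insert x A))) = cube_avg I (\<lambda>A. h (rad I a A + a x))"
    by (intro cube_avg_cong) (simp add: rad_insert assms)
  have "cube_avg I (\<lambda>A. (h (rad I a A - a x) + h (rad I a A + a x)) / 2)
      = (cube_avg I (\<lambda>A. h (rad I a A - a x)) + cube_avg I (\<lambda>A. h (rad I a A + a x))) / 2"
    using cube_avg_mult[of I "1/2" "\<lambda>A. h (rad I a A - a x) + h (rad I a A + a x)"]
    by (simp add: cube_avg_add)
  then show ?thesis
    by (simp add: cube_avg_insert assms 1 2)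
qed

lemma rad_second_moment:
  assumes "finite I"
  shows "cube_avg I (\<lambda>A. (rad I a A)\<^sup>2) = (\<Sum>k\<in>I. (a k)\<^sup>2)"
  using assms
proof (induction I rule: finite_induct)
  case (insert x I)
  have "((s - a x)\<^sup>2 + (s + a x)\<^sup>2) / 2 = s\<^sup>2 + (a x)\<^sup>2" for s
    by (simp add: power2_eq_square field_simps)
  then have "cube_avg (insert x I) (\<lambda>A. (rad (insert x I) a A)\<^sup>2)
      = cube_avg I (\<lambda>A. (rad I a A)\<^sup>2 + (a x)\<^sup>2)"
    by (simp only: cube_avg_rad_insert[OF insert.hyps, of "\<lambda>r. r\<^sup>2" a])
  then show ?case
    using insert by (simp add: cube_avg_add)
qed (simp add: rad_def)

lemma rad_fourth_moment:
  assumes "finite I"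
  shows "cube_avg I (\<lambda>A. (rad I a A) ^ 4) \<le> 3 * (\<Sum>k\<in>I. (a k)\<^sup>2)\<^sup>2"
  using assms
proof (induction I rule: finite_induct)
  case (insert x I)
  let ?S = "\<Sum>k\<in>I. (a k)\<^sup>2"
  have "((s - a x) ^ 4 + (s + a x) ^ 4) / 2 = s ^ 4 + 6 * (a x)\<^sup>2 * s\<^sup>2 + (a x) ^ 4" for s
    by (simp add: power2_eq_square power4_eq_xxxx field_simps)
  then have "cube_avg (insert x I) (\<lambda>A. (rad (insert x I) a A) ^ 4)
      = cube_avg I (\<lambda>A. (rad I a A) ^ 4 + 6 * (a x)\<^sup>2 * (rad I a A)\<^sup>2 + (a x) ^ 4)"
    by (simp only: cube_avg_rad_insert[OF insert.hyps, of "\<lambda>r. r ^ 4" a])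
  also have "\<dots> = cube_avg I (\<lambda>A. (rad I a A) ^ 4) + 6 * (a x)\<^sup>2 * ?S + (a x) ^ 4"
    using insert.hyps by (simp add: cube_avg_add cube_avg_mult rad_second_moment)
  \<comment> \<open>The coefficient of the last term is raised from 1 to 3 to complete the
    square.\<close>
  also have "\<dots> \<le> 3 * ?S\<^sup>2 + 6 * (a x)\<^sup>2 * ?S + 3 * (a x) ^ 4"
  proof -
    have "0 \<le> (a x) ^ 4" by simp
    then show ?thesis using insert.IH by linarith
  qed
  also have "\<dots> = 3 * (\<Sum>k\<in>insert x I. (a k)\<^sup>2)\<^sup>2"
    using insert.hyps by (simp add: power2_eq_square power4_eq_xxxx algebra_simps)
  finally show ?case .
qed (simp add: rad_def)

text \<open>The exponential moment of a single sign. Both \<open>ln (cosh t)\<close> and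
  \<open>t^2 / 2\<close> vanish at 0, and their derivatives satisfy \<open>tanh t \<le> t\<close>
  for \<open>t \<ge> 0\<close> because the derivative of \<open>tanh\<close> is at most 1.\<close>

lemma cosh_le_exp_half_square: "cosh x \<le> exp (x\<^sup>2 / 2)" for x :: real
proof -
  have pos: "cosh x \<le> exp (x\<^sup>2 / 2)" if "x \<ge> 0" for x :: real
  proof -
    have "ln (cosh 0) - 0\<^sup>2/2 \<ge> ln (cosh x) - x\<^sup>2 / 2"
    proof (rule DERIV_nonpos_imp_nonincreasing[OF that])
      fix t :: real assume t: "0 \<le> t" "t \<le> x"
      have "((\<lambda>t. ln (cosh t) - t\<^sup>2 / 2) has_real_derivative tanh t - t) (at t)"
        by (auto intro!: derivative_eq_intros simp: tanh_def field_simps)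
      moreover have "tanh t \<le> t"
      proof -
        have "tanh t - t \<le> tanh 0 - 0"
        proof (rule DERIV_nonpos_imp_nonincreasing[OF t(1)])
          fix s :: real
          have "((\<lambda>s. tanh s - s) has_real_derivative (1 - tanh s ^ 2) - 1) (at s)"
            by (auto intro!: derivative_eq_intros)
          moreover have "(1 - tanh s ^ 2) - 1 \<le> 0" by simp
          ultimately show "\<exists>y. ((\<lambda>s. tanh s - s) has_real_derivative y) (at s) \<and> y \<le> 0" by blast
        qed
        then show ?thesis by simp
      qed
      ultimately show "\<exists>y. ((\<lambda>t. ln (cosh t) - t\<^sup>2 / 2) has_real_derivative y) (at t) \<and> y \<le> 0"
        by (intro exI[of _ "tanh t - t"]) auto
    qed
    then have "ln (cosh x) \<le> x\<^sup>2 / 2" by simp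
    then show ?thesis by (metis cosh_real_pos exp_le_cancel_iff exp_ln)
  qed
  show ?thesis using pos[of x] pos[of "-x"] by (cases "x \<ge> 0") auto
qed

lemma rad_mgf:
  assumes "finite I"
  shows "cube_avg I (\<lambda>A. exp (rad I a A)) \<le> exp ((\<Sum>k\<in>I. (a k)\<^sup>2) / 2)"
  using assms
proof (induction I rule: finite_induct)
  case (insert x I)
  have "(exp (s - a x) + exp (s + a x)) / 2 = cosh (a x) * exp s" for s
    by (simp add: cosh_def exp_add exp_diff exp_minus field_simps)
  then have "cube_avg (insert x I) (\<lambda>A. exp (rad (insert x I) a A))
      = cosh (a x) * cube_avg I (\<lambda>A. exp (rad I a A))"
    using cube_avg_rad_insert[OF insert.hyps, of exp a] by (simp add: cube_avg_mult)
  also have "\<dots> \<le> exp ((a x)\<^sup>2 / 2) * exp ((\<Sum>k\<in>I. (a k)\<^sup>2) / 2)"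
    using insert.IH cosh_le_exp_half_square by (intro mult_mono) (auto simp: cube_avg_def sum_nonneg)
  also have "\<dots> = exp ((\<Sum>k\<in>insert x I. (a k)\<^sup>2) / 2)"
    using insert.hyps by (simp add: exp_add[symmetric] add_divide_distrib)
  finally show ?case .
qed (simp add: rad_def)

lemma rad_cmult: "rad I (\<lambda>k. c * a k) A = c * rad I a A"
  unfolding rad_def sum_distrib_left by (intro sum.cong) auto

lemma rad_diff: "rad I (\<lambda>k. a k - b k) A = rad I a A - rad I b A"
  unfolding rad_def sum_subtractf[symmetric] by (intro sum.cong) auto

lemma rad_compl: "rad I a (I - A) = - rad I a A"
  unfolding rad_def sum_negf[symmetric] by (intro sum.cong) auto

lemma rad_flip:
  assumes "finite I" "i \<in> I"
  shows "rad I a A - rad I a (sym_diff A {i}) \<le> 2 * \<bar>a i\<bar>"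
proof -
  have "rad I a B = (if i \<in> B then a i else - a i) + (\<Sum>k\<in>I - {i}. if k \<in> B then a k else - a k)" for B
    unfolding rad_def using assms by (subst sum.remove) auto
  moreover have "(\<Sum>k\<in>I - {i}. if k \<in> A then a k else - a k)
      = (\<Sum>k\<in>I - {i}. if k \<in> sym_diff A {i} then a k else - a k)"
    by (intro sum.cong) auto
  ultimately show ?thesis by auto
qed

text \<open>Efron-Stein: flipping the sign \<open>i\<close> lowers the maximum by at most \<open>2 \<bar>a l i\<bar>\<close>,
  where \<open>l\<close> attains the maximum before the flip.\<close>

lemma rad_Max_variance:
  fixes a :: "'b \<Rightarrow> 'a \<Rightarrow> real"
  assumes I: "finite I" and N: "finite N" "N \<noteq> {}"
    and s: "\<And>l. l \<in> N \<Longrightarrow> (\<Sum>k\<in>I. (a l k)\<^sup>2) \<le> s"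
  defines "Y \<equiv> \<lambda>A. Max ((\<lambda>l. rad I (a l) A) ` N)"
  shows "cube_avg I (\<lambda>A. (Y A - cube_avg I Y)\<^sup>2) \<le> 2 * s"
proof -
  \<comment> \<open>The maximiser controls increments only from above. The square of an increment
    splits into the squared positive parts at \<open>A\<close> and at its flip, and these have equal
    averages, so working with positive parts costs exactly a factor 2.\<close>
  define P where "P = (\<lambda>A i. max 0 (Y A - Y (sym_diff A {i})))"
  have split: "cube_avg I (\<lambda>A. (Y A - Y (sym_diff A {i}))\<^sup>2) = 2 * cube_avg I (\<lambda>A. (P A i)\<^sup>2)"
    if "i \<in> I" for i
  proof -
    have 1: "(Y A - Y (sym_diff A {i}))\<^sup>2 = (P A i)\<^sup>2 + (P (sym_diff A {i}) i)\<^sup>2" for A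
    proof -
      have "sym_diff (sym_diff A {i}) {i} = A" by auto
      then show ?thesis by (auto simp: P_def max_def power2_commute)
    qed
    have "cube_avg I (\<lambda>A. (P (sym_diff A {i}) i)\<^sup>2) = cube_avg I (\<lambda>A. (P A i)\<^sup>2)"
      by (rule cube_avg_flip[OF that, of "\<lambda>A. (P A i)\<^sup>2"])
    then show ?thesis unfolding 1 cube_avg_add by simp
  qed
  have bound: "(\<Sum>i\<in>I. (P A i)\<^sup>2) \<le> 4 * s" for A
  proof -
    have "Y A \<in> (\<lambda>l. rad I (a l) A) ` N"
      unfolding Y_def using N by (intro Max_in) auto
    then obtain l where l: "l \<in> N" "Y A = rad I (a l) A" by auto
    have "(P A i)\<^sup>2 \<le> 4 * (a l i)\<^sup>2" if i: "i \<in> I" for i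
    proof -
      have "Y (sym_diff A {i}) \<ge> rad I (a l) (sym_diff A {i})"
        unfolding Y_def using N l by (intro Max_ge) auto
      then have "P A i \<le> 2 * \<bar>a l i\<bar>" "0 \<le> P A i"
        using rad_flip[OF I i, of "a l" A] l unfolding P_def by auto
      then have "(P A i)\<^sup>2 \<le> (2 * \<bar>a l i\<bar>)\<^sup>2" by (intro power_mono) auto
      then show ?thesis by (simp add: power_mult_distrib)
    qed
    then have "(\<Sum>i\<in>I. (P A i)\<^sup>2) \<le> (\<Sum>i\<in>I. 4 * (a l i)\<^sup>2)" by (rule sum_mono)
    also have "\<dots> \<le> 4 * s" using s[OF l(1)] by (simp flip: sum_distrib_left)
    finally show ?thesis .
  qed
  have "cube_avg I (\<lambda>A. (Y A - cube_avg I Y)\<^sup>2)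
      \<le> (\<Sum>i\<in>I. cube_avg I (\<lambda>A. (Y A - Y (sym_diff A {i}))\<^sup>2)) / 4"
    unfolding cube_avg_square[OF I] by (rule cube_poincare[OF I])
  also have "\<dots> = cube_avg I (\<lambda>A. \<Sum>i\<in>I. (P A i)\<^sup>2) / 2"
    using split by (simp add: cube_avg_sum flip: sum_distrib_left)
  also have "\<dots> \<le> cube_avg I (\<lambda>A. 4 * s) / 2"
    using bound by (intro divide_right_mono cube_avg_mono) auto
  finally show ?thesis using I by simp
qed

lemma rad_Max_deviation:
  fixes a :: "'b \<Rightarrow> 'a \<Rightarrow> real"
  assumes I: "finite I" and N: "finite N" "N \<noteq> {}"
    and s: "\<And>l. l \<in> N \<Longrightarrow> (\<Sum>k\<in>I. (a l k)\<^sup>2) \<le> s"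
  defines "Y \<equiv> \<lambda>A. Max ((\<lambda>l. rad I (a l) A) ` N)"
  shows "cube_avg I (\<lambda>A. \<bar>Y A - cube_avg I Y\<bar>) \<le> sqrt (2 * s)"
proof (rule real_le_rsqrt)
  have "(cube_avg I (\<lambda>A. \<bar>Y A - cube_avg I Y\<bar>))\<^sup>2 \<le> cube_avg I (\<lambda>A. \<bar>Y A - cube_avg I Y\<bar>\<^sup>2)"
    by (rule cube_avg_jensen_square[OF I])
  also have "\<dots> \<le> 2 * s"
    unfolding Y_def power2_abs by (rule rad_Max_variance[OF I N s])
  finally show "(cube_avg I (\<lambda>A. \<bar>Y A - cube_avg I Y\<bar>))\<^sup>2 \<le> 2 * s" .
qed

lemma rad_Max_mean:
  fixes a :: "'b \<Rightarrow> 'a \<Rightarrow> real"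
  assumes I: "finite I" and N: "finite N" "N \<noteq> {}" "card N \<le> n" "n \<ge> 2"
    and s: "\<And>l. l \<in> N \<Longrightarrow> (\<Sum>k\<in>I. (a l k)\<^sup>2) \<le> s" and "s > 0"
  shows "cube_avg I (\<lambda>A. Max ((\<lambda>l. rad I (a l) A) ` N)) \<le> sqrt (2 * s * ln n)"
proof -
  define Y where "Y = (\<lambda>A. Max ((\<lambda>l. rad I (a l) A) ` N))"
  define \<mu> where "\<mu> = cube_avg I Y"
  \<comment> \<open>This choice makes \<open>exp (t\<^sup>2 * s / 2)\<close> equal to
    \<open>n\<close>, so the exponential moments and the number of competitors contribute
    equally.\<close>
  define t where "t = sqrt (2 * ln n / s)"
  have ln: "ln (real n) > 0" using N by simp
  have t: "t > 0" "t\<^sup>2 * s = 2 * ln n" using ln \<open>s > 0\<close> by (auto simp: t_def)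
  \<comment> \<open>Jensen's inequality for \<open>exp\<close>, through its tangent at the mean
    \<open>t * \<mu>\<close>.\<close>
  have "exp (t * \<mu>) = cube_avg I (\<lambda>A. exp (t * \<mu>) * (1 + (t * Y A - t * \<mu>)))"
    using I by (simp add: cube_avg_add cube_avg_diff cube_avg_mult \<mu>_def)
  also have "\<dots> \<le> cube_avg I (\<lambda>A. exp (t * Y A))"
  proof (intro cube_avg_mono)
    fix A
    have "exp (t * \<mu>) * (1 + (t * Y A - t * \<mu>)) \<le> exp (t * \<mu>) * exp (t * Y A - t * \<mu>)"
      by (intro mult_left_mono exp_ge_add_one_self) auto
    then show "exp (t * \<mu>) * (1 + (t * Y A - t * \<mu>)) \<le> exp (t * Y A)"
      by (simp flip: exp_add)
  qed
  also have "\<dots> \<le> cube_avg I (\<lambda>A. \<Sum>l\<in>N. exp (rad I (\<lambda>k. t * a l k) A))"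
  proof (intro cube_avg_mono)
    fix A
    have "Y A \<in> (\<lambda>l. rad I (a l) A) ` N"
      unfolding Y_def using N by (intro Max_in) auto
    then obtain l where l: "l \<in> N" "Y A = rad I (a l) A" by auto
    show "exp (t * Y A) \<le> (\<Sum>l\<in>N. exp (rad I (\<lambda>k. t * a l k) A))"
      unfolding l(2) rad_cmult using N l by (intro member_le_sum) auto
  qed
  also have "\<dots> \<le> (\<Sum>l\<in>N. exp (t\<^sup>2 * s / 2))"
    unfolding cube_avg_sum
  proof (intro sum_mono)
    fix l assume l: "l \<in> N"
    have "cube_avg I (\<lambda>A. exp (rad I (\<lambda>k. t * a l k) A)) \<le> exp ((\<Sum>k\<in>I. (t * a l k)\<^sup>2) / 2)"
      by (rule rad_mgf[OF I])
    also have "\<dots> \<le> exp (t\<^sup>2 * s / 2)"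
      using s[OF l] by (simp add: power_mult_distrib mult_left_mono flip: sum_distrib_left)
    finally show "cube_avg I (\<lambda>A. exp (rad I (\<lambda>k. t * a l k) A)) \<le> exp (t\<^sup>2 * s / 2)" .
  qed
  also have "\<dots> \<le> n * exp (t\<^sup>2 * s / 2)"
    using N by simp
  also have "\<dots> = exp (2 * ln n)"
    using N by (simp add: t(2) flip: exp_add) (simp add: exp_double power2_eq_square)
  finally have "t * \<mu> \<le> 2 * ln n" by simp
  then have "\<mu> \<le> 2 * ln n / t" using t by (simp add: field_simps)
  also have "\<dots> = sqrt (2 * s * ln n)"
  proof -
    have "(2 * ln n / t)\<^sup>2 = 2 * s * ln n"
      using t \<open>s > 0\<close> ln by (simp add: power_divide divide_simps) (simp add: power2_eq_square algebra_simps)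
    then show ?thesis using t ln by (metis divide_nonneg_pos less_eq_real_def mult_nonneg_nonneg real_sqrt_unique zero_le_numeral)
  qed
  finally show ?thesis unfolding \<mu>_def Y_def .
qed

text \<open>Paley-Zygmund, linearised: \<open>of_bool (y \<ge> 1/4) \<ge> y/2 - y\<^sup>2/16 - 1/8\<close> for \<open>y \<ge> 0\<close>.\<close>

lemma rad_anticoncentration:
  assumes I: "finite I" and pos: "(\<Sum>k\<in>I. (a k)\<^sup>2) > 0"
  shows "cube_avg I (\<lambda>A. of_bool ((rad I a A)\<^sup>2 \<ge> (\<Sum>k\<in>I. (a k)\<^sup>2) / 4)) \<ge> 3 / 16"
proof -
  define S where "S = (\<Sum>k\<in>I. (a k)\<^sup>2)"
  have S: "S > 0" using pos by (simp add: S_def)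
  have "3 / 16 \<le> 1 / (2 * S) * S - 1 / (16 * S\<^sup>2) * (3 * S\<^sup>2) - 1 / 8"
    using S by simp
  also have "\<dots> \<le> 1 / (2 * S) * cube_avg I (\<lambda>A. (rad I a A)\<^sup>2)
      - 1 / (16 * S\<^sup>2) * cube_avg I (\<lambda>A. (rad I a A) ^ 4) - 1 / 8"
    using rad_fourth_moment[OF I, of a] S
    by (intro diff_right_mono diff_mono mult_left_mono) (simp_all add: rad_second_moment I S_def[symmetric])
  also have "\<dots> = cube_avg I (\<lambda>A. 1 / (2 * S) * (rad I a A)\<^sup>2 - 1 / (16 * S\<^sup>2) * (rad I a A) ^ 4 - 1 / 8)"
    using I by (simp only: cube_avg_diff cube_avg_mult cube_avg_const)
  also have "\<dots> \<le> cube_avg I (\<lambda>A. of_bool ((rad I a A)\<^sup>2 \<ge> S / 4))"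
  proof (intro cube_avg_mono)
    fix A
    define y where "y = (rad I a A)\<^sup>2 / S"
    have y: "y \<ge> 0" "(rad I a A)\<^sup>2 = y * S" using S by (auto simp: y_def)
    have "(rad I a A) ^ 4 = ((rad I a A)\<^sup>2)\<^sup>2" by simp
    then have y4: "(rad I a A) ^ 4 = y\<^sup>2 * S\<^sup>2" by (simp only: y power_mult_distrib)
    have "y / 2 - y\<^sup>2 / 16 - 1 / 8 \<le> of_bool (y \<ge> 1 / 4)"
    proof (cases "y \<ge> 1 / 4")
      case True
      have "0 \<le> (y - 4)\<^sup>2" by simp
      then have "y / 2 - y\<^sup>2 / 16 \<le> 1" by (simp add: power2_eq_square algebra_simps)
      then show ?thesis using True by simp
    next
      case False
      have "y\<^sup>2 \<ge> 0" by simp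
      then have "y / 2 - y\<^sup>2 / 16 - 1 / 8 \<le> 0" using False by linarith
      then show ?thesis by (simp add: False)
    qed
    then show "1 / (2 * S) * (rad I a A)\<^sup>2 - 1 / (16 * S\<^sup>2) * (rad I a A) ^ 4 - 1 / 8
        \<le> of_bool ((rad I a A)\<^sup>2 \<ge> S / 4)"
      unfolding y4 y(2) using S by (simp add: field_simps)
  qed
  finally show ?thesis unfolding S_def .
qed

section \<open>Separated sets in metrics of negative type\<close>

text \<open>Greedy construction: the pairs are visited once, each raised until one of its ends is
  saturated, and later visits never undo saturation. The matching is fractional to fit arbitrary
  weights \<open>p\<close>. Its use is that unsaturated vertices span no pair of \<open>P\<close>,
  so a light matching leaves heavy sets without any pair between them.\<close>

lemma maximal_b_matching:
  fixes p :: "'b \<Rightarrow> real"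
  assumes V: "finite V" and P: "finite P" "P \<subseteq> V \<times> V" and p: "\<And>i. i \<in> V \<Longrightarrow> p i \<ge> 0"
  shows "\<exists>m. (\<forall>i j. m i j \<ge> 0) \<and> (\<forall>i j. (i, j) \<notin> P \<longrightarrow> m i j = 0)
    \<and> (\<forall>i\<in>V. (\<Sum>j\<in>V. m i j) \<le> p i) \<and> (\<forall>j\<in>V. (\<Sum>i\<in>V. m i j) \<le> p j)
    \<and> (\<forall>(i, j)\<in>P. (\<Sum>l\<in>V. m i l) = p i \<or> (\<Sum>l\<in>V. m l j) = p j)"
  using P
proof (induction P rule: finite_induct)
  case empty
  show ?case using p by (intro exI[of _ "\<lambda>_ _. 0"]) auto
next
  case (insert x P)
  obtain a b where x: "x = (a, b)" by (cases x)
  have ab: "a \<in> V" "b \<in> V" using insert.prems x by auto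
  have "P \<subseteq> V \<times> V" using insert.prems by auto
  from insert.IH[OF this] obtain m where good: "(\<forall>i j. m i j \<ge> 0) \<and> (\<forall>i j. (i, j) \<notin> P \<longrightarrow> m i j = 0)
    \<and> (\<forall>i\<in>V. (\<Sum>j\<in>V. m i j) \<le> p i) \<and> (\<forall>j\<in>V. (\<Sum>i\<in>V. m i j) \<le> p j)
    \<and> (\<forall>(i, j)\<in>P. (\<Sum>l\<in>V. m i l) = p i \<or> (\<Sum>l\<in>V. m l j) = p j)" ..
  then have m: "\<And>i j. m i j \<ge> 0" "\<And>i j. (i, j) \<notin> P \<Longrightarrow> m i j = 0"
    "\<And>i. i \<in> V \<Longrightarrow> (\<Sum>j\<in>V. m i j) \<le> p i" "\<And>j. j \<in> V \<Longrightarrow> (\<Sum>i\<in>V. m i j) \<le> p j"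
    by blast+
  have m_max: "(\<Sum>l\<in>V. m i l) = p i \<or> (\<Sum>l\<in>V. m l j) = p j" if "(i, j) \<in> P" for i j
    using good that by fast
  define t where "t = min (p a - (\<Sum>j\<in>V. m a j)) (p b - (\<Sum>i\<in>V. m i b))"
  have t: "t \<ge> 0" using m(3)[OF ab(1)] m(4)[OF ab(2)] by (simp add: t_def)
  define m' where "m' = (\<lambda>i j. m i j + (if i = a \<and> j = b then t else 0))"
  have row: "(\<Sum>j\<in>V. m' i j) = (\<Sum>j\<in>V. m i j) + (if i = a then t else 0)" for i
    using V ab by (simp add: m'_def sum.distrib)
  have col: "(\<Sum>i\<in>V. m' i j) = (\<Sum>i\<in>V. m i j) + (if j = b then t else 0)" for j
    using V ab by (cases "j = b") (simp_all add: m'_def sum.distrib)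
  have "\<forall>i j. m' i j \<ge> 0" using m(1) t by (simp add: m'_def)
  moreover have "\<forall>i j. (i, j) \<notin> insert x P \<longrightarrow> m' i j = 0" using m(2) x by (auto simp: m'_def)
  moreover have "\<forall>i\<in>V. (\<Sum>j\<in>V. m' i j) \<le> p i" using m(3) by (auto simp: row t_def)
  moreover have "\<forall>j\<in>V. (\<Sum>i\<in>V. m' i j) \<le> p j" using m(4) by (auto simp: col t_def)
  moreover have "\<forall>(i, j)\<in>insert x P. (\<Sum>l\<in>V. m' i l) = p i \<or> (\<Sum>l\<in>V. m' l j) = p j"
  proof (clarify)
    fix i j assume ij: "(i, j) \<in> insert x P" "(\<Sum>l\<in>V. m' l j) \<noteq> p j"
    show "(\<Sum>l\<in>V. m' i l) = p i"
    proof (cases "(i, j) = x")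
      case True
      then show ?thesis using ij x unfolding row col by (auto simp: t_def min_def split: if_splits)
    next
      case False
      then have P: "(i, j) \<in> P" using ij by auto
      then have V: "i \<in> V" "j \<in> V" using insert.prems by auto
      from m_max[OF P] show ?thesis
      proof
        assume "(\<Sum>l\<in>V. m i l) = p i"
        moreover have "(\<Sum>l\<in>V. m' i l) \<le> p i" using m(3)[OF V(1)] by (auto simp: row t_def)
        ultimately show ?thesis using t by (auto simp: row split: if_splits)
      next
        assume "(\<Sum>l\<in>V. m l j) = p j"
        moreover have "(\<Sum>l\<in>V. m' l j) \<le> p j" using m(4)[OF V(2)] by (auto simp: col t_def)
        ultimately show ?thesis using t ij by (auto simp: col split: if_splits)
      qed
    qed
  qed
  ultimately show ?case by blast
qed

text \<open>The median is the least value of \<open>f\<close> whose lower level set carries half of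
  the weight. What lies strictly below it is either empty or the lower level set of the next smaller
  value, which carries less than half.\<close>

lemma weighted_median:
  fixes p f :: "'b \<Rightarrow> real"
  assumes U: "finite U" "U \<noteq> {}" and p: "\<And>i. i \<in> U \<Longrightarrow> p i \<ge> 0"
  shows "\<exists>\<tau>. sum p U / 2 \<le> sum p {i\<in>U. f i \<le> \<tau>} \<and> sum p U / 2 \<le> sum p {i\<in>U. f i \<ge> \<tau>}"
proof -
  let ?T = "{t \<in> f ` U. sum p U / 2 \<le> sum p {i\<in>U. f i \<le> t}}"
  have "{i\<in>U. f i \<le> Max (f ` U)} = U" using U by auto
  then have "Max (f ` U) \<in> ?T" using U p by (auto simp: sum_nonneg)
  then have ne: "?T \<noteq> {}" by blast
  have fin: "finite ?T" using U by simp
  define \<tau> where "\<tau> = Min ?T"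
  have \<tau>: "\<tau> \<in> ?T" unfolding \<tau>_def by (rule Min_in[OF fin ne])
  have "sum p {i\<in>U. f i < \<tau>} \<le> sum p U / 2"
  proof (cases "{i\<in>U. f i < \<tau>} = {}")
    case True
    then show ?thesis using p by (simp add: sum_nonneg del: Collect_empty_eq)
  next
    case False
    let ?s = "Max (f ` {i\<in>U. f i < \<tau>})"
    have s: "?s \<in> f ` {i\<in>U. f i < \<tau>}" using U False by (intro Max_in) auto
    have "?s \<notin> ?T"
    proof
      assume "?s \<in> ?T"
      then have "\<tau> \<le> ?s" unfolding \<tau>_def using fin by (intro Min_le)
      then show False using s by auto
    qed
    then have "sum p {i\<in>U. f i \<le> ?s} < sum p U / 2" using s by auto
    moreover have "{i\<in>U. f i \<le> ?s} = {i\<in>U. f i < \<tau>}"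
      using s U by (auto intro!: Max_ge)
    ultimately show ?thesis by simp
  qed
  moreover have "sum p U = sum p {i\<in>U. f i < \<tau>} + sum p {i\<in>U. f i \<ge> \<tau>}"
    using U by (subst sum.union_disjoint[symmetric]) (auto intro!: sum.cong)
  ultimately have "sum p U / 2 \<le> sum p {i\<in>U. f i \<ge> \<tau>}" by linarith
  then show ?thesis using \<tau> by auto
qed

section \<open>Projections and chaining in a weighted metric of negative type\<close>

locale weighted_neg_type =
  fixes I :: "'a set" and V :: "'b set" and v :: "'b \<Rightarrow> 'a \<Rightarrow> real" and p :: "'b \<Rightarrow> real"
  assumes fin_I: "finite I" and fin_V: "finite V" and card_V: "card V \<ge> 2"
    and p_pos: "\<And>i. i \<in> V \<Longrightarrow> p i > 0"
    and triangle: "\<And>i j k. i \<in> V \<Longrightarrow> j \<in> V \<Longrightarrow> k \<in> V \<Longrightarrow>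
      (\<Sum>x\<in>I. (v i x - v k x)\<^sup>2) \<le> (\<Sum>x\<in>I. (v i x - v j x)\<^sup>2) + (\<Sum>x\<in>I. (v j x - v k x)\<^sup>2)"
begin

text \<open>The squared Euclidean distance is itself used as the metric. Its triangle inequality
  keeps \<open>k\<close> steps of length \<open>\<Delta>\<close> within \<open>k * \<Delta>\<close>,
  whereas the Euclidean triangle inequality alone would allow \<open>k^2 * \<Delta>\<close>; the
  variances along a chain therefore grow only linearly.\<close>

definition D :: "'b \<Rightarrow> 'b \<Rightarrow> real" where "D i j = (\<Sum>x\<in>I. (v i x - v j x)\<^sup>2)"

definition W :: real where "W = sum p V"

lemma D_triangle: "i \<in> V \<Longrightarrow> j \<in> V \<Longrightarrow> k \<in> V \<Longrightarrow> D i k \<le> D i j + D j k"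
  unfolding D_def by (rule triangle)

lemma D_self [simp]: "D i i = 0" by (simp add: D_def)

lemma D_nonneg: "D i j \<ge> 0" by (simp add: D_def sum_nonneg)

lemma D_commute: "D i j = D j i"
  unfolding D_def by (intro sum.cong refl) (simp add: power2_commute)

lemma V_nonempty: "V \<noteq> {}" using card_V by auto

lemma W_pos: "W > 0"
  unfolding W_def using V_nonempty fin_V p_pos by (intro sum_pos) auto

text \<open>A crude numerical bound; it ensures that rounding \<open>4 * sqrt (ln (card V))\<close>
  down still leaves a chaining step.\<close>

lemma sqrt_ln_card_ge: "sqrt (ln (card V)) \<ge> 1 / 2"
proof -
  have "ln (real (card V)) \<ge> ln 2" using card_V by simp
  moreover have "ln (1 / 2 :: real) \<le> 1 / 2 - 1" by (rule ln_le_minus_one) simp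
  ultimately have "ln (real (card V)) \<ge> (1/2)\<^sup>2" by (simp add: power2_eq_square ln_div)
  then show ?thesis by (rule real_le_rsqrt)
qed

definition nbhd :: "real \<Rightarrow> 'b \<Rightarrow> 'b set" where "nbhd s i = {l\<in>V. D i l \<le> s}"

text \<open>The best gain in projection over \<open>i\<close> among the vertices at distance at most
  \<open>s\<close>: a maximum of at most \<open>card V\<close> signed sums, each of variance at most
  \<open>s\<close>.\<close>

definition reach :: "real \<Rightarrow> 'b \<Rightarrow> 'a set \<Rightarrow> real" where
  "reach s i A = Max ((\<lambda>l. rad I (\<lambda>x. v l x - v i x) A) ` nbhd s i)"

text \<open>The quantity tracked by the chaining argument: matchings push it up at every step, and
  the union bound caps it.\<close>

definition total_reach :: "real \<Rightarrow> real" where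
  "total_reach s = (\<Sum>i\<in>V. p i * cube_avg I (reach s i))"

lemma finite_nbhd: "finite (nbhd s i)" using fin_V by (simp add: nbhd_def)

lemma self_in_nbhd: "i \<in> V \<Longrightarrow> s \<ge> 0 \<Longrightarrow> i \<in> nbhd s i" by (simp add: nbhd_def)

text \<open>The best target \<open>l\<close> for \<open>j\<close> is also a candidate for
  \<open>i\<close> in the enlarged neighbourhood, and projections add up along \<open>i\<close>,
  \<open>j\<close>, \<open>l\<close>.\<close>

lemma reach_step:
  assumes ij: "i \<in> V" "j \<in> V" "D i j \<le> \<Delta>" and s: "s \<ge> 0"
  shows "reach (s + \<Delta>) i A \<ge> reach s j A + (rad I (v j) A - rad I (v i) A)"
proof -
  have "reach s j A \<in> (\<lambda>l. rad I (\<lambda>x. v l x - v j x) A) ` nbhd s j"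
    unfolding reach_def using self_in_nbhd[OF ij(2) s] finite_nbhd by (intro Max_in) auto
  then obtain l where l: "l \<in> nbhd s j" "reach s j A = rad I (\<lambda>x. v l x - v j x) A" by auto
  have "l \<in> nbhd (s + \<Delta>) i"
    using l(1) ij D_triangle[of i j l] by (auto simp: nbhd_def)
  then have "rad I (\<lambda>x. v l x - v i x) A \<le> reach (s + \<Delta>) i A"
    unfolding reach_def using finite_nbhd by (intro Max_ge) auto
  then show ?thesis using l(2) by (simp add: rad_diff)
qed

lemma reach_mono:
  assumes "i \<in> V" "0 \<le> s" "s \<le> t"
  shows "reach s i A \<le> reach t i A"
  unfolding reach_def using self_in_nbhd[OF assms(1,2)] finite_nbhd assms(3)
  by (intro Max_mono image_mono) (auto simp: nbhd_def)

text \<open>The deviation depends on \<open>s\<close> but not on the number of vertices. A union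
  bound would bring in a factor \<open>sqrt (ln (card V))\<close> that the gain of a step cannot pay
  for.\<close>

lemma reach_deviation:
  assumes "i \<in> V" "s \<ge> 0"
  shows "cube_avg I (\<lambda>A. \<bar>reach s i A - cube_avg I (reach s i)\<bar>) \<le> sqrt (2 * s)"
  unfolding reach_def
  by (rule rad_Max_deviation[OF fin_I finite_nbhd])
    (use self_in_nbhd[OF assms] D_commute in \<open>auto simp: nbhd_def D_def\<close>)

lemma total_reach_le:
  assumes "s > 0"
  shows "total_reach s \<le> W * sqrt (2 * s * ln (card V))"
proof -
  have "cube_avg I (reach s i) \<le> sqrt (2 * s * ln (card V))" if i: "i \<in> V" for i
    unfolding reach_def
  proof (rule rad_Max_mean[OF fin_I finite_nbhd _ _ card_V _ assms])
    show "nbhd s i \<noteq> {}" using self_in_nbhd[OF i, of s] assms by auto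
    show "card (nbhd s i) \<le> card V" using fin_V by (intro card_mono) (auto simp: nbhd_def)
    show "(\<Sum>k\<in>I. (v l k - v i k)\<^sup>2) \<le> s" if "l \<in> nbhd s i" for l
      using that D_commute by (auto simp: nbhd_def D_def)
  qed
  then have "total_reach s \<le> (\<Sum>i\<in>V. p i * sqrt (2 * s * ln (card V)))"
    unfolding total_reach_def using p_pos by (intro sum_mono mult_left_mono) (auto intro: less_imp_le)
  then show ?thesis by (simp add: W_def sum_distrib_right)
qed

text \<open>Chaining along the matching edges gains \<open>\<sigma>\<close> per unit of matched weight. The values at the two
  ends of an edge may be replaced by their means at the cost of the deviation, and the means cancel
  because the matching is symmetric on average.\<close>

lemma total_reach_step:
  fixes m :: "'a set \<Rightarrow> 'b \<Rightarrow> 'b \<Rightarrow> real"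
  assumes m_nonneg: "\<And>A i j. m A i j \<ge> 0"
    and m_supp: "\<And>A i j. i \<in> V \<Longrightarrow> j \<in> V \<Longrightarrow> m A i j \<noteq> 0 \<Longrightarrow>
      D i j \<le> \<Delta> \<and> rad I (v j) A - rad I (v i) A \<ge> \<sigma>"
    and rows: "\<And>A i. i \<in> V \<Longrightarrow> (\<Sum>j\<in>V. m A i j) \<le> p i"
    and cols: "\<And>A j. j \<in> V \<Longrightarrow> (\<Sum>i\<in>V. m A i j) \<le> p j"
    and sym: "\<And>i j. cube_avg I (\<lambda>A. m A i j) = cube_avg I (\<lambda>A. m A j i)"
    and \<Delta>: "\<Delta> \<ge> 0" and s: "s \<ge> 0"
  shows "total_reach (s + \<Delta>) \<ge> total_reach s
    + \<sigma> * cube_avg I (\<lambda>A. \<Sum>i\<in>V. \<Sum>j\<in>V. m A i j) - 2 * W * sqrt (2 * s)"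
proof -
  define \<mu> where "\<mu> = (\<lambda>i. cube_avg I (reach s i))"
  define err where "err = (\<lambda>A i. \<bar>reach s i A - \<mu> i\<bar>)"
  have pointwise: "(\<Sum>i\<in>V. p i * reach s i A) + \<sigma> * (\<Sum>i\<in>V. \<Sum>j\<in>V. m A i j)
      + (\<Sum>i\<in>V. \<Sum>j\<in>V. m A i j * (\<mu> j - \<mu> i)) - 2 * (\<Sum>i\<in>V. p i * err A i)
      \<le> (\<Sum>i\<in>V. p i * reach (s + \<Delta>) i A)" for A
  proof -
    have "p i * reach s i A + (\<Sum>j\<in>V. m A i j * (\<sigma> + (\<mu> j - \<mu> i) - err A j - err A i))
        \<le> p i * reach (s + \<Delta>) i A" if i: "i \<in> V" for i
    proof -
      have "(\<Sum>j\<in>V. m A i j * (\<sigma> + (\<mu> j - \<mu> i) - err A j - err A i))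
          \<le> (\<Sum>j\<in>V. m A i j * (reach (s + \<Delta>) i A - reach s i A))"
      proof (intro sum_mono)
        fix j assume j: "j \<in> V"
        show "m A i j * (\<sigma> + (\<mu> j - \<mu> i) - err A j - err A i)
            \<le> m A i j * (reach (s + \<Delta>) i A - reach s i A)"
        proof (cases "m A i j = 0")
          case False
          note m_supp[OF i j False]
          then have "\<sigma> + (\<mu> j - \<mu> i) - err A j - err A i \<le> reach (s + \<Delta>) i A - reach s i A"
            using reach_step[OF i j _ s, of \<Delta> A] unfolding err_def by linarith
          then show ?thesis by (intro mult_left_mono m_nonneg)
        qed simp
      qed
      \<comment> \<open>The matched share of \<open>i\<close> is at most \<open>p i\<close>, and
        reach only grows with the radius, so the unmatched share may be credited with the same
        increase.\<close>
      also have "\<dots> \<le> p i * (reach (s + \<Delta>) i A - reach s i A)"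
        unfolding sum_distrib_right[symmetric]
        using rows[OF i] reach_mono[OF i s, of "s + \<Delta>" A] \<Delta> by (intro mult_right_mono) auto
      finally show ?thesis by (simp add: algebra_simps)
    qed
    then have "(\<Sum>i\<in>V. p i * reach s i A + (\<Sum>j\<in>V. m A i j * (\<sigma> + (\<mu> j - \<mu> i) - err A j - err A i)))
        \<le> (\<Sum>i\<in>V. p i * reach (s + \<Delta>) i A)" by (rule sum_mono)
    moreover have "(\<Sum>i\<in>V. \<Sum>j\<in>V. m A i j * err A i) \<le> (\<Sum>i\<in>V. p i * err A i)"
      unfolding sum_distrib_right[symmetric]
      by (intro sum_mono mult_right_mono rows) (auto simp: err_def)
    moreover have "(\<Sum>i\<in>V. \<Sum>j\<in>V. m A i j * err A j) \<le> (\<Sum>j\<in>V. p j * err A j)"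
      by (subst sum.swap, unfold sum_distrib_right[symmetric])
        (intro sum_mono mult_right_mono cols, auto simp: err_def)
    moreover have "(\<Sum>i\<in>V. p i * reach s i A + (\<Sum>j\<in>V. m A i j * (\<sigma> + (\<mu> j - \<mu> i) - err A j - err A i)))
        = (\<Sum>i\<in>V. p i * reach s i A) + \<sigma> * (\<Sum>i\<in>V. \<Sum>j\<in>V. m A i j)
        + (\<Sum>i\<in>V. \<Sum>j\<in>V. m A i j * (\<mu> j - \<mu> i))
        - (\<Sum>i\<in>V. \<Sum>j\<in>V. m A i j * err A j) - (\<Sum>i\<in>V. \<Sum>j\<in>V. m A i j * err A i)"
      unfolding sum_distrib_left sum.distrib[symmetric] sum_subtractf[symmetric]
      by (intro sum.cong refl) (simp add: algebra_simps sum.distrib sum_subtractf sum_distrib_left)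
    ultimately show ?thesis by linarith
  qed
  have cancel: "cube_avg I (\<lambda>A. \<Sum>i\<in>V. \<Sum>j\<in>V. m A i j * (\<mu> j - \<mu> i)) = 0"
  proof -
    let ?e = "\<lambda>i j. cube_avg I (\<lambda>A. m A i j)"
    have "(\<Sum>i\<in>V. \<Sum>j\<in>V. ?e i j * \<mu> i) = (\<Sum>i\<in>V. \<Sum>j\<in>V. ?e i j * \<mu> j)"
      by (subst sum.swap) (simp add: sym)
    then show ?thesis
      by (simp only: cube_avg_sum cube_avg_mult_right right_diff_distrib sum_subtractf cube_avg_diff)
  qed
  have err: "cube_avg I (\<lambda>A. \<Sum>i\<in>V. p i * err A i) \<le> W * sqrt (2 * s)"
  proof -
    have "cube_avg I (\<lambda>A. \<Sum>i\<in>V. p i * err A i) \<le> (\<Sum>i\<in>V. p i * sqrt (2 * s))"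
      unfolding cube_avg_sum cube_avg_mult err_def \<mu>_def using p_pos reach_deviation[OF _ s]
      by (intro sum_mono mult_left_mono) (auto intro: less_imp_le)
    then show ?thesis by (simp add: W_def sum_distrib_right)
  qed
  have "total_reach s + \<sigma> * cube_avg I (\<lambda>A. \<Sum>i\<in>V. \<Sum>j\<in>V. m A i j)
      + 0 - 2 * cube_avg I (\<lambda>A. \<Sum>i\<in>V. p i * err A i)
      = cube_avg I (\<lambda>A. (\<Sum>i\<in>V. p i * reach s i A) + \<sigma> * (\<Sum>i\<in>V. \<Sum>j\<in>V. m A i j)
      + (\<Sum>i\<in>V. \<Sum>j\<in>V. m A i j * (\<mu> j - \<mu> i)) - 2 * (\<Sum>i\<in>V. p i * err A i))"
    unfolding cube_avg_diff cube_avg_add cube_avg_mult cancel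
    unfolding total_reach_def cube_avg_sum cube_avg_mult ..
  also have "\<dots> \<le> cube_avg I (\<lambda>A. \<Sum>i\<in>V. p i * reach (s + \<Delta>) i A)"
    by (intro cube_avg_mono pointwise)
  also have "\<dots> = total_reach (s + \<Delta>)"
    by (simp add: total_reach_def cube_avg_sum cube_avg_mult)
  finally show ?thesis using err by simp
qed

text \<open>The exponents are chosen so that each of \<open>\<lfloor>4 \<surd>(ln n)\<rfloor>\<close> steps of \<open>total_reach_step\<close>
  gains at least \<open>\<sigma> W / 128\<close>, which contradicts \<open>total_reach_le\<close>.\<close>

lemma symmetric_matching_small:
  fixes m :: "'a set \<Rightarrow> 'b \<Rightarrow> 'b \<Rightarrow> real"
  defines "\<Delta> \<equiv> 1 / (2 ^ 24 * W * sqrt (ln (card V)))" and "\<sigma> \<equiv> sqrt (1 / (32 * W))"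
  assumes m_nonneg: "\<And>A i j. m A i j \<ge> 0"
    and m_supp: "\<And>A i j. i \<in> V \<Longrightarrow> j \<in> V \<Longrightarrow> m A i j \<noteq> 0 \<Longrightarrow>
      D i j \<le> \<Delta> \<and> rad I (v j) A - rad I (v i) A \<ge> \<sigma>"
    and rows: "\<And>A i. i \<in> V \<Longrightarrow> (\<Sum>j\<in>V. m A i j) \<le> p i"
    and cols: "\<And>A j. j \<in> V \<Longrightarrow> (\<Sum>i\<in>V. m A i j) \<le> p j"
    and sym: "\<And>i j. cube_avg I (\<lambda>A. m A i j) = cube_avg I (\<lambda>A. m A j i)"
  shows "cube_avg I (\<lambda>A. \<Sum>i\<in>V. \<Sum>j\<in>V. m A i j) < W / 64"
proof (rule ccontr)
  assume "\<not> ?thesis"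
  then have big: "cube_avg I (\<lambda>A. \<Sum>i\<in>V. \<Sum>j\<in>V. m A i j) \<ge> W / 64" by simp
  define x where "x = sqrt (ln (card V))"
  have x: "x \<ge> 1/2" unfolding x_def by (rule sqrt_ln_card_ge)
  have x2: "x\<^sup>2 = ln (card V)" unfolding x_def using card_V by simp
  note W = W_pos
  have \<Delta>: "\<Delta> > 0" "\<Delta> = 1 / (2 ^ 24 * W * x)" using W x by (auto simp: \<Delta>_def x_def[symmetric])
  have \<sigma>: "\<sigma> > 0" "\<sigma>\<^sup>2 = 1 / (32 * W)" using W by (auto simp: \<sigma>_def)
  define K where "K = nat \<lfloor>4 * x\<rfloor>"
  have K: "real K \<le> 4 * x" "real K > 4 * x - 1" using x unfolding K_def by linarith+
  have grow: "total_reach (k * \<Delta>) \<ge> k * (\<sigma> * W / 128)" if "k \<le> K" for k :: nat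
    using that
  proof (induction k)
    case 0
    have "reach 0 i A \<ge> 0" if "i \<in> V" for i A
    proof -
      have "rad I (\<lambda>x. v i x - v i x) A \<le> reach 0 i A"
        unfolding reach_def using self_in_nbhd[OF that, of 0] finite_nbhd
        by (intro Max_ge imageI finite_imageI) auto
      moreover have "rad I (\<lambda>x. v i x - v i x) A = 0" unfolding rad_diff by simp
      ultimately show ?thesis by linarith
    qed
    then have "cube_avg I (reach 0 i) \<ge> 0" if "i \<in> V" for i
      using that by (simp add: cube_avg_def sum_nonneg)
    then show ?case unfolding total_reach_def using p_pos
      by (simp add: sum_nonneg less_imp_le)
  next
    case (Suc k)
    have "k * \<Delta> \<le> (4 * x) * \<Delta>" using Suc.prems K(1) \<Delta> by (intro mult_right_mono) auto
    also have "\<dots> = 1 / (2 ^ 22 * W)" using x W unfolding \<Delta>(2) by (simp add: field_simps)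
    \<comment> \<open>Both sides are at most \<open>1 / (2^21 * W)\<close>, and the right-hand side
      equals it. The error of a step then consumes at most \<open>\<sigma> * W / 128\<close>, half
      of what the matching gains.\<close>
    finally have "2 * (k * \<Delta>) \<le> (\<sigma> / 256)\<^sup>2"
      unfolding power_divide \<sigma>(2) using W by (simp add: field_simps)
    then have "sqrt (2 * (k * \<Delta>)) \<le> \<sigma> / 256" using \<sigma>(1) by (intro real_le_lsqrt) auto
    then have "2 * W * sqrt (2 * (k * \<Delta>)) \<le> 2 * W * (\<sigma> / 256)" using W by (intro mult_left_mono) auto
    moreover have "\<sigma> * (W / 64) \<le> \<sigma> * cube_avg I (\<lambda>A. \<Sum>i\<in>V. \<Sum>j\<in>V. m A i j)"
      using big \<sigma>(1) by (intro mult_left_mono) auto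
    moreover have "total_reach (k * \<Delta> + \<Delta>) \<ge> total_reach (k * \<Delta>)
        + \<sigma> * cube_avg I (\<lambda>A. \<Sum>i\<in>V. \<Sum>j\<in>V. m A i j) - 2 * W * sqrt (2 * (k * \<Delta>))"
      using \<Delta>(1) by (intro total_reach_step m_nonneg m_supp rows cols sym) auto
    moreover have "total_reach (k * \<Delta>) \<ge> k * (\<sigma> * W / 128)" using Suc by simp
    ultimately show ?case by (simp add: algebra_simps)
  qed
  have K0: "real K > 0" using K x by linarith
  have "K * (\<sigma> * W / 128) \<le> W * sqrt (2 * (K * \<Delta>) * x\<^sup>2)"
    using grow[of K] total_reach_le[of "K * \<Delta>"] K0 \<Delta>(1) unfolding x2 by simp
  then have "K * \<sigma> / 128 \<le> sqrt (2 * (K * \<Delta>) * x\<^sup>2)" using W by (simp add: field_simps)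
  then have "(K * \<sigma> / 128)\<^sup>2 \<le> (sqrt (2 * (K * \<Delta>) * x\<^sup>2))\<^sup>2" using K0 \<sigma>(1) by (intro power_mono) auto
  also have "\<dots> = 2 * (K * \<Delta>) * x\<^sup>2" using K0 \<Delta>(1) by (intro real_sqrt_pow2) auto
  finally have "K\<^sup>2 * (1 / (32 * W)) / 2 ^ 14 \<le> 2 * (K * \<Delta>) * x\<^sup>2"
    by (simp add: power_mult_distrib power_divide \<sigma>(2))
  \<comment> \<open>Cancelling \<open>K\<close> and \<open>1 / W\<close> leaves the factor
    \<open>2 * 2^19 / 2^24 = 1 / 16\<close>; this is incompatible with a step count near
    \<open>4 * x\<close>.\<close>
  then have "K * x \<le> x * x / 16"
    unfolding \<Delta>(2) using W x K0 by (simp add: field_simps power2_eq_square)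
  then have "K \<le> x / 16" using x by (simp add: field_simps)
  then show False using K(2) x by linarith
qed

text \<open>Suppose the conclusion fails. For every sign vector, a maximal matching must then nearly
  exhaust one of any two sets split by a projection gap, since their unsaturated parts are far apart
  and cannot both be heavy. The spread hypothesis makes such gaps frequent on average, so the mean
  matching is too large for \<open>symmetric_matching_small\<close>. The bound on the matching is
  linear in the weight of split pairs, so it can be averaged over all sign vectors without selecting
  good ones.\<close>

lemma separated_sets:
  assumes spread: "\<And>i. i \<in> V \<Longrightarrow> sum p {j\<in>V. D i j \<le> 1 / (2 * W)} < W / 4"
  shows "\<exists>L R. L \<subseteq> V \<and> R \<subseteq> V \<and> sum p L \<ge> W / 64 \<and> sum p R \<ge> W / 64
    \<and> (\<forall>i\<in>L. \<forall>j\<in>R. D i j \<ge> 1 / (2 ^ 24 * W * sqrt (ln (card V))))"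
proof (rule ccontr)
  assume no: "\<not> ?thesis"
  define \<Delta> where "\<Delta> = 1 / (2 ^ 24 * W * sqrt (ln (card V)))"
  \<comment> \<open>Vertices farther apart than \<open>1 / (2 * W)\<close> often have projections
    differing by at least \<open>2 * \<sigma>\<close>, whose square is \<open>1 / (8 * W)\<close>.
    One of the two is then at least \<open>\<sigma>\<close> away from any given median.\<close>
  define \<sigma> where "\<sigma> = sqrt (1 / (32 * W))"
  define q where "q = (\<lambda>i A. rad I (v i) A)"
  note W = W_pos
  have \<sigma>: "\<sigma> > 0" "\<sigma>\<^sup>2 = 1 / (32 * W)" using W by (auto simp: \<sigma>_def)
  define P where "P = (\<lambda>A. {(i, j) \<in> V \<times> V. D i j \<le> \<Delta> \<and> q j A - q i A \<ge> \<sigma>})"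
  have finP: "finite (P A)" for A
    using fin_V by (auto simp: P_def intro: finite_subset[of _ "V \<times> V"])
  let ?good = "\<lambda>A m. (\<forall>i j. m i j \<ge> 0) \<and> (\<forall>i j. (i, j) \<notin> P A \<longrightarrow> m i j = 0)
    \<and> (\<forall>i\<in>V. (\<Sum>j\<in>V. m i j) \<le> p i) \<and> (\<forall>j\<in>V. (\<Sum>i\<in>V. m i j) \<le> p j)
    \<and> (\<forall>(i, j)\<in>P A. (\<Sum>l\<in>V. m i l) = p i \<or> (\<Sum>l\<in>V. m l j) = p j)"
  have "\<forall>A. \<exists>m. ?good A m"
    using finP p_pos by (intro allI maximal_b_matching fin_V) (auto simp: P_def less_imp_le)
  from choice[OF this] obtain m where good: "\<And>A. ?good A (m A)" by blast
  have m: "\<And>A i j. m A i j \<ge> 0" "\<And>A i j. (i, j) \<notin> P A \<Longrightarrow> m A i j = 0"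
    "\<And>A i. i \<in> V \<Longrightarrow> (\<Sum>j\<in>V. m A i j) \<le> p i" "\<And>A j. j \<in> V \<Longrightarrow> (\<Sum>i\<in>V. m A i j) \<le> p j"
    using good by blast+
  have m_max: "(\<Sum>l\<in>V. m A i l) = p i \<or> (\<Sum>l\<in>V. m A l j) = p j" if "(i, j) \<in> P A" for A i j
    using good[of A] that by fast
  define M where "M = (\<lambda>A. \<Sum>i\<in>V. \<Sum>j\<in>V. m A i j)"
  have M_swap: "M A = (\<Sum>j\<in>V. \<Sum>i\<in>V. m A i j)" for A unfolding M_def by (rule sum.swap)
  have small: "cube_avg I M < W / 64"
  proof -
    txt \<open>Negating all signs reverses matching edges, so averaging with the transposed matching of the
      complementary sign vector makes the matching symmetric on average.\<close>
    define m' where "m' = (\<lambda>A i j. (m A i j + m (I - A) j i) / 2)"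
    have "cube_avg I (\<lambda>A. \<Sum>i\<in>V. \<Sum>j\<in>V. m' A i j) < W / 64"
    proof (rule symmetric_matching_small)
      show "m' A i j \<ge> 0" for A i j using m(1) by (simp add: m'_def)
      show "D i j \<le> 1 / (2 ^ 24 * W * sqrt (ln (card V))) \<and> sqrt (1 / (32 * W)) \<le> rad I (v j) A - rad I (v i) A"
        if "i \<in> V" "j \<in> V" "m' A i j \<noteq> 0" for A i j
      proof -
        have "(i, j) \<in> P A \<or> (j, i) \<in> P (I - A)"
          using that(3) m(2)[of i j A] m(2)[of j i "I - A"]
          unfolding m'_def by (cases "(i, j) \<in> P A") auto
        then show ?thesis
          using D_commute[of i j] by (auto simp: P_def q_def rad_compl \<Delta>_def \<sigma>_def)
      qed
      show "(\<Sum>j\<in>V. m' A i j) \<le> p i" if "i \<in> V" for A i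
        using m(3)[OF that, of A] m(4)[OF that, of "I - A"]
        unfolding m'_def sum_divide_distrib[symmetric] sum.distrib by simp
      show "(\<Sum>i\<in>V. m' A i j) \<le> p j" if "j \<in> V" for A j
        using m(4)[OF that, of A] m(3)[OF that, of "I - A"]
        unfolding m'_def sum_divide_distrib[symmetric] sum.distrib by simp
      have avg: "cube_avg I (\<lambda>A. m' A i j) = (cube_avg I (\<lambda>A. m A i j) + cube_avg I (\<lambda>A. m A j i)) / 2" for i j
        using cube_avg_compl[of I "\<lambda>A. m A j i"] cube_avg_mult[of I "1/2" "\<lambda>A. m A i j + m (I - A) j i"]
        by (simp add: m'_def cube_avg_add)
      show "cube_avg I (\<lambda>A. m' A i j) = cube_avg I (\<lambda>A. m' A j i)" for i j
        unfolding avg by simp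
    qed
    also have "(\<lambda>A. \<Sum>i\<in>V. \<Sum>j\<in>V. m' A i j) = (\<lambda>A. 1/2 * (M A + M (I - A)))"
    proof
      fix A
      have "(\<Sum>i\<in>V. \<Sum>j\<in>V. m' A i j) = (M A + (\<Sum>i\<in>V. \<Sum>j\<in>V. m (I - A) j i)) / 2"
        unfolding m'_def M_def sum_divide_distrib[symmetric] sum.distrib ..
      then show "(\<Sum>i\<in>V. \<Sum>j\<in>V. m' A i j) = 1/2 * (M A + M (I - A))"
        using M_swap[of "I - A"] by simp
    qed
    finally show ?thesis
      unfolding cube_avg_mult cube_avg_add cube_avg_compl by simp
  qed
  \<comment> \<open>Saturated vertices on either side weigh at most \<open>M A\<close>. No pair of
    \<open>P A\<close> joins the remaining ones, so these are farther apart than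
    \<open>\<Delta>\<close> and one remainder is lighter than \<open>W / 64\<close>.\<close>
  have cut: "sum p L - W / 64 \<le> M A \<or> sum p R - W / 64 \<le> M A"
    if LR: "L \<subseteq> V" "R \<subseteq> V" and gap: "\<And>i j. i \<in> L \<Longrightarrow> j \<in> R \<Longrightarrow> q j A - q i A \<ge> \<sigma>" for L R A
  proof -
    let ?sL = "{i\<in>L. (\<Sum>j\<in>V. m A i j) = p i}" and ?sR = "{j\<in>R. (\<Sum>i\<in>V. m A i j) = p j}"
    have "D i j \<ge> \<Delta>" if ij: "i \<in> L - ?sL" "j \<in> R - ?sR" for i j
    proof (rule ccontr)
      assume "\<not> ?thesis"
      then have "(i, j) \<in> P A" using ij LR gap[of i j] by (auto simp: P_def)
      then show False using m_max ij by blast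
    qed
    moreover have "L - ?sL \<subseteq> V" "R - ?sR \<subseteq> V" using LR by auto
    ultimately have "\<not> (sum p (L - ?sL) \<ge> W / 64 \<and> sum p (R - ?sR) \<ge> W / 64)"
      using no[unfolded not_ex, THEN spec, THEN spec, of "L - ?sL" "R - ?sR"]
      unfolding \<Delta>_def[symmetric] by (simp only: ball_simps simp_thms) blast
    moreover have "sum p L \<le> sum p (L - ?sL) + M A"
    proof -
      have "sum p ?sL = (\<Sum>i\<in>?sL. \<Sum>j\<in>V. m A i j)" by (intro sum.cong) auto
      also have "\<dots> \<le> M A"
        unfolding M_def using fin_V LR m(1) by (intro sum_mono2) (auto simp: sum_nonneg)
      finally show ?thesis
        using sum.subset_diff[of ?sL L p] finite_subset[OF LR(1) fin_V] by simp
    qed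
    moreover have "sum p R \<le> sum p (R - ?sR) + M A"
    proof -
      have "sum p ?sR = (\<Sum>j\<in>?sR. \<Sum>i\<in>V. m A i j)" by (intro sum.cong) auto
      also have "\<dots> \<le> M A"
        unfolding M_swap using fin_V LR m(1) by (intro sum_mono2) (auto simp: sum_nonneg)
      finally show ?thesis
        using sum.subset_diff[of ?sR R p] finite_subset[OF LR(2) fin_V] by simp
    qed
    ultimately show ?thesis by linarith
  qed
  define Q where "Q = (\<lambda>A. \<Sum>i\<in>V. \<Sum>j\<in>V. p i * p j * of_bool ((q i A - q j A)\<^sup>2 \<ge> 1 / (8 * W)))"
  have lower: "1 / (4 * W) * Q A - W / 64 \<le> M A" for A
  proof -
    obtain \<tau> where \<tau>: "W / 2 \<le> sum p {i\<in>V. q i A \<le> \<tau>}" "W / 2 \<le> sum p {i\<in>V. q i A \<ge> \<tau>}"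
      using weighted_median[OF fin_V V_nonempty, of p "\<lambda>i. q i A"] p_pos
      unfolding W_def by (auto intro: less_imp_le)
    let ?L = "{i\<in>V. q i A \<le> \<tau> - \<sigma>}" and ?R = "{i\<in>V. q i A \<ge> \<tau> + \<sigma>}"
    have half: "sum p X \<le> W / 2" if "X \<subseteq> V" "Y \<subseteq> V" "X \<inter> Y = {}" "W / 2 \<le> sum p Y" for X Y
    proof -
      have "sum p X + sum p Y = sum p (X \<union> Y)"
        using that fin_V by (intro sum.union_disjoint[symmetric]) (auto intro: finite_subset)
      also have "\<dots> \<le> W" unfolding W_def using that fin_V p_pos
        by (intro sum_mono2) (auto intro: less_imp_le)
      finally show ?thesis using that by linarith
    qed
    \<comment> \<open>The opposite side, from the median upwards, carries at least half of the
      weight and \<open>?L\<close> at most half. Hence whichever alternative of \<open>cut\<close>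
      holds, it bounds \<open>?L\<close>.\<close>
    have L: "sum p ?L \<le> M A + W / 64"
      using cut[of ?L "{i\<in>V. q i A \<ge> \<tau>}" A] half[of ?L "{i\<in>V. q i A \<ge> \<tau>}"] \<tau>(2) \<sigma>(1) by fastforce
    have R: "sum p ?R \<le> M A + W / 64"
      using cut[of "{i\<in>V. q i A \<le> \<tau>}" ?R A] half[of ?R "{i\<in>V. q i A \<le> \<tau>}"] \<tau>(1) \<sigma>(1) by fastforce
    let ?c = "\<lambda>i. of_bool (i \<in> ?L) + of_bool (i \<in> ?R) :: real"
    have pc: "(\<Sum>i\<in>V. p i * ?c i) = sum p ?L + sum p ?R"
    proof -
      have ind: "(\<Sum>i\<in>V. p i * of_bool (i \<in> X)) = sum p X" if "X \<subseteq> V" for X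
        using that fin_V by (simp add: sum.If_cases of_bool_def if_distrib Int_absorb1 cong: if_cong)
      have "?L \<subseteq> V" "?R \<subseteq> V" by auto
      then show ?thesis unfolding distrib_left sum.distrib by (simp only: ind)
    qed
    \<comment> \<open>Each split pair is charged to an end in \<open>?L\<close> or
      \<open>?R\<close>; summing over the other end gives \<open>W\<close>, once for each of the two
      positions in the ordered pair.\<close>
    have "Q A \<le> (\<Sum>i\<in>V. \<Sum>j\<in>V. p i * p j * (?c i + ?c j))"
      unfolding Q_def
    proof (intro sum_mono mult_left_mono)
      fix i j assume ij: "i \<in> V" "j \<in> V"
      show "0 \<le> p i * p j" using p_pos ij by (simp add: less_imp_le)
      show "of_bool ((q i A - q j A)\<^sup>2 \<ge> 1 / (8 * W)) \<le> ?c i + ?c j"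
      proof (cases "(q i A - q j A)\<^sup>2 \<ge> 1 / (8 * W)")
        case True
        have "(2 * \<sigma>)\<^sup>2 = 1 / (8 * W)" unfolding power_mult_distrib \<sigma>(2) by simp
        then have "(2 * \<sigma>)\<^sup>2 \<le> \<bar>q i A - q j A\<bar>\<^sup>2" using True by simp
        then have "2 * \<sigma> \<le> \<bar>q i A - q j A\<bar>" by (rule power2_le_imp_le) simp
        then have "i \<in> ?L \<or> i \<in> ?R \<or> j \<in> ?L \<or> j \<in> ?R" using ij by auto
        then show ?thesis using True by auto
      qed simp
    qed
    also have "\<dots> = 2 * W * (sum p ?L + sum p ?R)"
    proof -
      have 1: "(\<Sum>i\<in>V. \<Sum>j\<in>V. p i * p j * ?c j) = W * (sum p ?L + sum p ?R)"
        unfolding pc[symmetric] W_def sum_product by (simp only: mult.assoc)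
      have 2: "(\<Sum>i\<in>V. \<Sum>j\<in>V. p i * p j * ?c i) = W * (sum p ?L + sum p ?R)"
        unfolding 1[symmetric] by (subst sum.swap) (simp only: mult.commute)
      have "(\<Sum>i\<in>V. \<Sum>j\<in>V. p i * p j * (?c i + ?c j))
          = (\<Sum>i\<in>V. \<Sum>j\<in>V. p i * p j * ?c i) + (\<Sum>i\<in>V. \<Sum>j\<in>V. p i * p j * ?c j)"
        unfolding sum.distrib[symmetric] by (intro sum.cong refl) (rule distrib_left)
      then show ?thesis unfolding 1 2 by simp
    qed
    also have "\<dots> \<le> 2 * W * (2 * (M A + W / 64))"
      using L R W by (intro mult_left_mono) auto
    finally show ?thesis using W by (simp add: field_simps)
  qed
  \<comment> \<open>Weight more than \<open>3 / 4 * W\<close> lies beyond distance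
    \<open>1 / (2 * W)\<close> from each vertex, and there anticoncentration contributes at least
    \<open>3 / 16\<close>.\<close>
  have "9 / 64 * W\<^sup>2 \<le> cube_avg I Q"
  proof -
    have "(\<Sum>i\<in>V. p i * (9 / 64 * W)) \<le> (\<Sum>i\<in>V. \<Sum>j\<in>V. p i * p j
        * cube_avg I (\<lambda>A. of_bool ((q i A - q j A)\<^sup>2 \<ge> 1 / (8 * W))))"
    proof (intro sum_mono)
      fix i assume i: "i \<in> V"
      let ?N = "{j\<in>V. D i j \<le> 1 / (2 * W)}"
      have "W = sum p (V - ?N) + sum p ?N"
        unfolding W_def using fin_V by (intro sum.subset_diff) auto
      then have "3 / 4 * W \<le> sum p (V - ?N)" using spread[OF i] by linarith
      then have "9 / 64 * W \<le> (\<Sum>j\<in>V - ?N. p j * (3 / 16))"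
        unfolding sum_distrib_right[symmetric] by simp
      also have "\<dots> \<le> (\<Sum>j\<in>V - ?N. p j * cube_avg I (\<lambda>A. of_bool ((q i A - q j A)\<^sup>2 \<ge> 1 / (8 * W))))"
      proof (intro sum_mono mult_left_mono)
        fix j assume j: "j \<in> V - ?N"
        then have far: "D i j > 1 / (2 * W)" by auto
        moreover have "0 < 1 / (2 * W)" using W by simp
        ultimately have "D i j > 0" by linarith
        then have "3 / 16 \<le> cube_avg I (\<lambda>A. of_bool ((rad I (\<lambda>x. v i x - v j x) A)\<^sup>2 \<ge> D i j / 4))"
          unfolding D_def by (rule rad_anticoncentration[OF fin_I])
        also have "\<dots> \<le> cube_avg I (\<lambda>A. of_bool ((q i A - q j A)\<^sup>2 \<ge> 1 / (8 * W)))"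
          using far by (intro cube_avg_mono) (auto simp: q_def rad_diff)
        finally show "3 / 16 \<le> cube_avg I (\<lambda>A. of_bool ((q i A - q j A)\<^sup>2 \<ge> 1 / (8 * W)))" .
        show "0 \<le> p j" using p_pos j by (simp add: less_imp_le)
      qed
      also have "\<dots> \<le> (\<Sum>j\<in>V. p j * cube_avg I (\<lambda>A. of_bool ((q i A - q j A)\<^sup>2 \<ge> 1 / (8 * W))))"
        using fin_V p_pos by (intro sum_mono2)
          (auto intro!: mult_nonneg_nonneg divide_nonneg_nonneg sum_nonneg simp: cube_avg_def less_imp_le)
      finally have "p i * (9 / 64 * W) \<le> p i * \<dots>"
        using p_pos[OF i] by (intro mult_left_mono) auto
      then show "p i * (9 / 64 * W) \<le> (\<Sum>j\<in>V. p i * p j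
        * cube_avg I (\<lambda>A. of_bool ((q i A - q j A)\<^sup>2 \<ge> 1 / (8 * W))))"
        by (simp add: sum_distrib_left mult.assoc)
    qed
    moreover have "(\<Sum>i\<in>V. p i * (9 / 64 * W)) = 9 / 64 * W\<^sup>2"
      unfolding sum_distrib_right[symmetric] by (simp add: W_def power2_eq_square)
    ultimately show ?thesis
      by (simp add: Q_def cube_avg_sum cube_avg_mult)
  qed
  \<comment> \<open>The left-hand side is \<open>9 / 256 - 4 / 256 = 5 / 256\<close> of
    \<open>W\<close>, above the \<open>4 / 256\<close> that \<open>small\<close> permits.\<close>
  then have "1 / (4 * W) * (9 / 64 * W\<^sup>2) - W / 64 \<le> 1 / (4 * W) * cube_avg I Q - W / 64"
    using W by (intro diff_right_mono mult_left_mono) auto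
  also have "\<dots> = cube_avg I (\<lambda>A. 1 / (4 * W) * Q A - W / 64)"
    using fin_I by (simp only: cube_avg_diff cube_avg_mult cube_avg_const)
  also have "\<dots> \<le> cube_avg I M" by (intro cube_avg_mono lower)
  finally show False using small W by (simp add: power2_eq_square)
qed

end

section \<open>Directed potential functions\<close>

text \<open>Directed distance to \<open>Z\<close>, truncated at 0 because \<open>G\<close> may be
  negative; the truncation survives in the one-sided Lipschitz bound as
  \<open>max 0 (G i j)\<close>. The opposite orientation is obtained by applying the lemma to the
  reversed \<open>G\<close>.\<close>

lemma distance_to_set:
  fixes G :: "'b \<Rightarrow> 'b \<Rightarrow> real"
  assumes Z: "finite Z" "Z \<noteq> {}" "Z \<subseteq> V" and self: "\<And>z. z \<in> Z \<Longrightarrow> G z z \<le> 0"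
    and tri: "\<And>i j k. i \<in> V \<Longrightarrow> j \<in> V \<Longrightarrow> k \<in> V \<Longrightarrow> G i k \<le> G i j + G j k"
  defines "f \<equiv> \<lambda>i. max 0 (Min (G i ` Z))"
  shows "\<And>z. z \<in> Z \<Longrightarrow> f z = 0"
    and "\<And>i j. i \<in> V \<Longrightarrow> j \<in> V \<Longrightarrow> f i \<le> f j + max 0 (G i j)"
    and "\<And>i c. (\<And>z. z \<in> Z \<Longrightarrow> c \<le> G i z) \<Longrightarrow> c \<le> f i"
proof -
  have Min_le': "Min (G i ` Z) \<le> G i z" if "z \<in> Z" for i z
    using that Z by (intro Min_le) auto
  show "f z = 0" if "z \<in> Z" for z
    using Min_le'[OF that, of z] self[OF that] by (simp add: f_def)
  show "f i \<le> f j + max 0 (G i j)" if ij: "i \<in> V" "j \<in> V" for i j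
  proof -
    have "Min (G j ` Z) \<in> G j ` Z" using Z by (intro Min_in) auto
    then obtain z where z: "z \<in> Z" "Min (G j ` Z) = G j z" by auto
    then have "Min (G i ` Z) \<le> G i j + G j z"
      using Min_le'[OF z(1), of i] tri[OF ij, of z] z(1) Z(3) by force
    then show ?thesis unfolding f_def z(2) by linarith
  qed
  show "c \<le> f i" if "\<And>z. z \<in> Z \<Longrightarrow> c \<le> G i z" for i c
  proof -
    have "c \<le> Min (G i ` Z)" using that Z by (intro Min.boundedI) auto
    then show ?thesis by (simp add: f_def)
  qed
qed

context weighted_neg_type
begin

text \<open>A heavy ball of radius \<open>1 / (2 * W)\<close> loses at most \<open>1 / 2\<close> of
  the total distance 1 seen from its centre. Without such a ball the separated sets apply, with
  \<open>W / 64\<close> weight at distance \<open>\<Delta>\<close>. Distances are bounded below by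
  \<open>\<delta>\<close> uniformly over \<open>U\<close>, so the bound passes to every subset of
  \<open>U\<close>.\<close>

lemma heavy_set_far_from_average:
  assumes avg: "\<And>i. i \<in> V \<Longrightarrow> (\<Sum>j\<in>V. p j * D i j) \<ge> 1"
  shows "\<exists>U \<delta>. U \<subseteq> V \<and> sum p U \<ge> W / 64 \<and> (\<forall>i\<in>V. \<delta> i \<ge> 0 \<and> (\<forall>u\<in>U. D i u \<ge> \<delta> i))
    \<and> (\<Sum>i\<in>V. p i * \<delta> i) \<ge> 1 / (2 ^ 30 * sqrt (ln (card V)))"
proof (cases "\<exists>i\<in>V. sum p {j\<in>V. D i j \<le> 1 / (2 * W)} \<ge> W / 4")
  case True
  then obtain c where c: "c \<in> V" "sum p {j\<in>V. D c j \<le> 1 / (2 * W)} \<ge> W / 4" by blast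
  define U where "U = {j\<in>V. D c j \<le> 1 / (2 * W)}"
  define \<delta> where "\<delta> = (\<lambda>i. max 0 (D c i - 1 / (2 * W)))"
  have "D i u \<ge> \<delta> i" if "i \<in> V" "u \<in> U" for i u
    using D_triangle[of c u i] that c(1) D_commute[of i u] D_nonneg[of i u] by (auto simp: \<delta>_def U_def)
  moreover have "(\<Sum>i\<in>V. p i * \<delta> i) \<ge> 1 / 2"
  proof -
    have "(\<Sum>i\<in>V. p i * (D c i - 1 / (2 * W))) \<le> (\<Sum>i\<in>V. p i * \<delta> i)"
      using p_pos by (intro sum_mono mult_left_mono) (auto simp: \<delta>_def less_imp_le)
    moreover have "(\<Sum>i\<in>V. p i * (D c i - 1 / (2 * W))) = (\<Sum>i\<in>V. p i * D c i) - W * (1 / (2 * W))"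
      unfolding W_def sum_distrib_right right_diff_distrib sum_subtractf ..
    ultimately show ?thesis using avg[OF c(1)] W_pos by simp
  qed
  moreover have "1 / (2 ^ 30 * sqrt (ln (card V))) \<le> 1 / 2"
  proof -
    have "1 / (2 ^ 30 * x) \<le> 1 / 2" if "x \<ge> 1 / 2" for x :: real
      using that by (simp add: field_simps)
    then show ?thesis using sqrt_ln_card_ge .
  qed
  ultimately show ?thesis
    using c(2) W_pos by (intro exI[of _ U] exI[of _ \<delta>]) (auto simp: U_def[symmetric], auto simp: U_def \<delta>_def)
next
  case False
  then obtain L R where LR: "L \<subseteq> V" "R \<subseteq> V" "sum p L \<ge> W / 64" "sum p R \<ge> W / 64"
    "\<And>i j. i \<in> L \<Longrightarrow> j \<in> R \<Longrightarrow> D i j \<ge> 1 / (2 ^ 24 * W * sqrt (ln (card V)))"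
    using separated_sets by (force simp: not_le)
  define \<Delta> where "\<Delta> = 1 / (2 ^ 24 * W * sqrt (ln (card V)))"
  have "sqrt (ln (card V)) > 0" using sqrt_ln_card_ge by linarith
  then have \<Delta>: "\<Delta> \<ge> 0" using W_pos unfolding \<Delta>_def by (intro divide_nonneg_nonneg mult_nonneg_nonneg) auto
  have "1 / (2 ^ 30 * sqrt (ln (card V))) = W / 64 * \<Delta>"
    using W_pos by (simp add: \<Delta>_def)
  also have "\<dots> \<le> sum p L * \<Delta>" using LR(3) \<Delta> by (intro mult_right_mono)
  also have "\<dots> = (\<Sum>i\<in>V. p i * (if i \<in> L then \<Delta> else 0))"
    using LR(1) fin_V by (simp add: sum_distrib_right if_distrib sum.If_cases Int_absorb1 cong: if_cong)
  finally show ?thesis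
    using LR \<Delta> D_nonneg
    by (intro exI[of _ R] exI[of _ "\<lambda>i. if i \<in> L then \<Delta> else 0"]) (auto simp: \<Delta>_def)
qed

text \<open>Cutting the heavy set at the median of \<open>\<rho>\<close>, every vertex sees half of it without paying for the
  potential, either along or against the direction of the quasimetric.\<close>

lemma potential_function:
  fixes \<rho> :: "'b \<Rightarrow> real"
  defines "G \<equiv> \<lambda>i j. D i j / 2 + \<rho> j - \<rho> i"
  assumes avg: "\<And>i. i \<in> V \<Longrightarrow> (\<Sum>j\<in>V. p j * D i j) \<ge> 1"
  shows "\<exists>Z f. Z \<subseteq> V \<and> sum p Z \<ge> W / 128 \<and> (\<forall>i. f i \<ge> 0) \<and> (\<forall>i\<in>Z. f i = 0)
    \<and> (\<Sum>i\<in>V. p i * f i) \<ge> 1 / (2 ^ 32 * sqrt (ln (card V)))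
    \<and> ((\<forall>i\<in>V. \<forall>j\<in>V. f i \<le> f j + max 0 (G i j)) \<or> (\<forall>i\<in>V. \<forall>j\<in>V. f j \<le> f i + max 0 (G i j)))"
proof -
  obtain U \<delta> where U: "U \<subseteq> V" "sum p U \<ge> W / 64"
    and \<delta>: "\<And>i. i \<in> V \<Longrightarrow> \<delta> i \<ge> 0" "\<And>i u. i \<in> V \<Longrightarrow> u \<in> U \<Longrightarrow> D i u \<ge> \<delta> i"
    and total: "(\<Sum>i\<in>V. p i * \<delta> i) \<ge> 1 / (2 ^ 30 * sqrt (ln (card V)))"
    using heavy_set_far_from_average[OF avg] by blast
  have finU: "finite U" using U(1) fin_V by (rule finite_subset)
  have "U \<noteq> {}" using U(2) W_pos by auto
  then obtain \<tau> where \<tau>: "sum p U / 2 \<le> sum p {i\<in>U. \<rho> i \<le> \<tau>}" "sum p U / 2 \<le> sum p {i\<in>U. \<rho> i \<ge> \<tau>}"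
    using weighted_median[OF finU, of p \<rho>] p_pos U(1) by (meson less_imp_le subsetD)
  \<comment> \<open>Common to both orientations: \<open>H\<close> is \<open>G\<close> or its
    reverse, \<open>Z\<close> is the half of \<open>U\<close> on one side of the median, and
    \<open>Q\<close> selects the vertices on the other side.\<close>
  have concl: "\<exists>f. (\<forall>i. f i \<ge> 0) \<and> (\<forall>i\<in>Z. f i = 0)
      \<and> (\<Sum>i\<in>V. p i * f i) \<ge> 1 / (2 ^ 32 * sqrt (ln (card V)))
      \<and> (\<forall>i\<in>V. \<forall>j\<in>V. f i \<le> f j + max 0 (H i j))"
    if Z: "Z \<subseteq> U" "sum p Z \<ge> sum p U / 2"
      and tri: "\<And>i j k. i \<in> V \<Longrightarrow> j \<in> V \<Longrightarrow> k \<in> V \<Longrightarrow> H i k \<le> H i j + H j k"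
      and self: "\<And>i. H i i \<le> 0"
      and half: "(\<Sum>i\<in>{i\<in>V. Q i}. p i * \<delta> i) \<ge> (\<Sum>i\<in>V. p i * \<delta> i) / 2"
      and far: "\<And>i z. i \<in> V \<Longrightarrow> Q i \<Longrightarrow> z \<in> Z \<Longrightarrow> H i z \<ge> \<delta> i / 2"
    for Z H Q
  proof -
    have Z': "finite Z" "Z \<noteq> {}" "Z \<subseteq> V"
      using Z U W_pos finite_subset[OF Z(1) finU] by auto
    define f where "f = (\<lambda>i. max 0 (Min (H i ` Z)))"
    have f_eq: "f i = max 0 (Min (H i ` Z))" for i by (simp add: f_def)
    note f = distance_to_set[of Z V H, OF Z' self tri, folded f_eq]
    have le: "\<delta> i / 2 \<le> f i" if "i \<in> V" "Q i" for i
      using that by (intro f(3) far)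
    \<comment> \<open>The factor 4 pays for keeping only the vertices with \<open>Q\<close> and for
      the \<open>1 / 2\<close> in front of \<open>D\<close>.\<close>
    have "1 / (2 ^ 32 * sqrt (ln (card V))) = 1 / (2 ^ 30 * sqrt (ln (card V))) / 4" by simp
    also have "\<dots> \<le> (\<Sum>i\<in>V. p i * \<delta> i) / 2 / 2" using total by simp
    also have "\<dots> \<le> (\<Sum>i\<in>{i\<in>V. Q i}. p i * \<delta> i) / 2" using half by simp
    also have "\<dots> = (\<Sum>i\<in>{i\<in>V. Q i}. p i * (\<delta> i / 2))" by (simp add: sum_divide_distrib)
    also have "\<dots> \<le> (\<Sum>i\<in>{i\<in>V. Q i}. p i * f i)"
      using le p_pos by (intro sum_mono mult_left_mono) (auto simp del: divide_le_eq_numeral1 intro: less_imp_le)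
    also have "\<dots> \<le> (\<Sum>i\<in>V. p i * f i)"
      using fin_V p_pos by (intro sum_mono2) (auto simp: f_def less_imp_le)
    finally show ?thesis using f(1,2) by (intro exI[of _ f]) (auto simp: f_def)
  qed
  have split: "(\<Sum>i\<in>V. p i * \<delta> i) = (\<Sum>i\<in>{i\<in>V. \<rho> i \<le> \<tau>}. p i * \<delta> i) + (\<Sum>i\<in>{i\<in>V. \<rho> i > \<tau>}. p i * \<delta> i)"
    using fin_V by (subst sum.union_disjoint[symmetric]) (auto intro!: sum.cong)
  show ?thesis
  proof (cases "(\<Sum>i\<in>{i\<in>V. \<rho> i \<le> \<tau>}. p i * \<delta> i) \<ge> (\<Sum>i\<in>V. p i * \<delta> i) / 2")
    case True
    let ?Z = "{i\<in>U. \<rho> i \<ge> \<tau>}"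
    have "\<exists>f. (\<forall>i. f i \<ge> 0) \<and> (\<forall>i\<in>?Z. f i = 0)
      \<and> (\<Sum>i\<in>V. p i * f i) \<ge> 1 / (2 ^ 32 * sqrt (ln (card V)))
      \<and> (\<forall>i\<in>V. \<forall>j\<in>V. f i \<le> f j + max 0 (G i j))"
    proof (rule concl[OF _ \<tau>(2) _ _ True])
      show "G i k \<le> G i j + G j k" if "i \<in> V" "j \<in> V" "k \<in> V" for i j k
        using D_triangle[OF that] by (simp add: G_def)
      show "G i z \<ge> \<delta> i / 2" if "i \<in> V" "\<rho> i \<le> \<tau>" "z \<in> ?Z" for i z
        using \<delta>(2)[of i z] that by (auto simp: G_def)
    qed (auto simp: G_def)
    moreover have "?Z \<subseteq> V" "sum p ?Z \<ge> W / 128" using U \<tau>(2) by auto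
    ultimately show ?thesis by blast
  next
    case False
    let ?Z = "{i\<in>U. \<rho> i \<le> \<tau>}"
    have half: "(\<Sum>i\<in>{i\<in>V. \<rho> i > \<tau>}. p i * \<delta> i) \<ge> (\<Sum>i\<in>V. p i * \<delta> i) / 2"
      using False split by linarith
    have "\<exists>f. (\<forall>i. f i \<ge> 0) \<and> (\<forall>i\<in>?Z. f i = 0)
      \<and> (\<Sum>i\<in>V. p i * f i) \<ge> 1 / (2 ^ 32 * sqrt (ln (card V)))
      \<and> (\<forall>i\<in>V. \<forall>j\<in>V. f i \<le> f j + max 0 (G j i))"
    proof (rule concl[OF _ \<tau>(1) _ _ half, where H = "\<lambda>i j. G j i"])
      show "G k i \<le> G j i + G k j" if "i \<in> V" "j \<in> V" "k \<in> V" for i j k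
        using D_triangle[of k j i] that by (simp add: G_def)
      show "G z i \<ge> \<delta> i / 2" if "i \<in> V" "\<rho> i > \<tau>" "z \<in> ?Z" for i z
        using \<delta>(2)[of i z] that D_commute[of i z] by (auto simp: G_def)
    qed (auto simp: G_def)
    moreover have "?Z \<subseteq> V" "sum p ?Z \<ge> W / 128" using U \<tau>(1) by auto
    ultimately show ?thesis by blast
  qed
qed

end

section \<open>Linear programming duality\<close>

lemma sum_insert_update:
  assumes "finite X" "y \<notin> X"
  shows "(\<Sum>i\<in>insert y X. a i * (x(y := t)) i) = a y * t + (\<Sum>i\<in>X. a i * x i :: real)"
proof -
  have "(\<Sum>i\<in>X. a i * (x(y := t)) i) = (\<Sum>i\<in>X. a i * x i)"
    using assms by (intro sum.cong) auto
  then show ?thesis using assms by simp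
qed

text \<open>Fourier-Motzkin elimination, one variable per induction step. Constraints are pairs of a
  coefficient vector and a right-hand side; \<open>\<mu> c'\<close> expresses the derived constraint \<open>c'\<close> as a
  nonnegative combination of the original ones.\<close>

lemma farkas_set:
  fixes C :: "(('v \<Rightarrow> real) \<times> real) set"
  assumes "finite X" "finite C" "\<And>x. \<exists>c\<in>C. (\<Sum>i\<in>X. fst c i * x i) > snd c"
  shows "\<exists>l. (\<forall>c\<in>C. l c \<ge> 0) \<and> (\<forall>i\<in>X. (\<Sum>c\<in>C. l c * fst c i) = 0) \<and> (\<Sum>c\<in>C. l c * snd c) < 0"
  using assms
proof (induction X arbitrary: C rule: finite_induct)
  case empty
  then obtain c where c: "c \<in> C" "snd c < 0" by auto
  have "(\<Sum>d\<in>C. of_bool (d = c) * snd d) = snd c"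
    using c empty.prems by (subst sum.remove[of _ c]) (auto intro!: sum.neutral)
  then show ?case using c by (intro exI[of _ "\<lambda>d. of_bool (d = c)"]) auto
next
  case (insert y X)
  define P where "P = {c\<in>C. fst c y > 0}"
  define N where "N = {c\<in>C. fst c y < 0}"
  define comb where "comb = (\<lambda>(c, d). ((\<lambda>i. - fst d y * fst c i + fst c y * fst d i),
    - fst d y * snd c + fst c y * snd d) :: ('v \<Rightarrow> real) \<times> real)"
  define C' where "C' = {c\<in>C. fst c y = 0} \<union> comb ` (P \<times> N)"
  have fin: "finite P" "finite N" "finite C'"
    using insert.prems(1) by (auto simp: P_def N_def C'_def)
  have infeasible: "\<exists>c\<in>C'. (\<Sum>i\<in>X. fst c i * x i) > snd c" for x
  proof (rule ccontr)
    assume "\<not> ?thesis"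
    then have x: "\<And>c. c \<in> C' \<Longrightarrow> (\<Sum>i\<in>X. fst c i * x i) \<le> snd c" by force
    define b where "b = (\<lambda>c. (snd c - (\<Sum>i\<in>X. fst c i * x i)) / fst c y)"
    have NP: "b d \<le> b c" if c: "c \<in> P" and d: "d \<in> N" for c d
    proof -
      have "(\<Sum>i\<in>X. fst (comb (c, d)) i * x i) \<le> snd (comb (c, d))"
        using c d by (intro x) (auto simp: C'_def)
      then have "- fst d y * (\<Sum>i\<in>X. fst c i * x i) + fst c y * (\<Sum>i\<in>X. fst d i * x i)
          \<le> - fst d y * snd c + fst c y * snd d"
        by (simp add: comb_def sum_distrib_left sum.distrib algebra_simps sum_negf sum_subtractf)
      then show ?thesis
        using c d by (simp add: b_def P_def N_def field_simps)
    qed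
    \<comment> \<open>Any value between the lower bounds from \<open>N\<close> and the upper bounds
      from \<open>P\<close> extends \<open>x\<close> to \<open>y\<close>. Empty families are split
      off because \<open>Min\<close> and \<open>Max\<close> give no bound for them.\<close>
    obtain t where t: "\<And>d. d \<in> N \<Longrightarrow> b d \<le> t" "\<And>c. c \<in> P \<Longrightarrow> t \<le> b c"
    proof (cases "N = {}")
      case True
      show ?thesis
      proof (cases "P = {}")
        case True
        with \<open>N = {}\<close> show ?thesis using that[of 0] by auto
      next
        case False
        with \<open>N = {}\<close> show ?thesis using that[of "Min (b ` P)"] fin by auto
      qed
    next
      case False
      then show ?thesis using that[of "Max (b ` N)"] fin NP by auto
    qed
    obtain c where c: "c \<in> C" "(\<Sum>i\<in>insert y X. fst c i * (x(y := t)) i) > snd c"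
      using insert.prems(2) by blast
    have gt: "fst c y * t + (\<Sum>i\<in>X. fst c i * x i) > snd c"
      using c(2) unfolding sum_insert_update[OF insert.hyps] .
    consider "fst c y = 0" | "c \<in> P" | "c \<in> N" using c(1) by (force simp: P_def N_def)
    then show False
    proof cases
      case 1
      then show ?thesis using gt x[of c] c(1) by (simp add: C'_def)
    next
      case 2
      then show ?thesis using gt t(2)[OF 2] by (simp add: b_def P_def field_simps)
    next
      case 3
      then show ?thesis using gt t(1)[OF 3] by (simp add: b_def N_def field_simps)
    qed
  qed
  obtain l' where l': "\<And>c. c \<in> C' \<Longrightarrow> l' c \<ge> 0" "\<And>i. i \<in> X \<Longrightarrow> (\<Sum>c\<in>C'. l' c * fst c i) = 0"
    "(\<Sum>c\<in>C'. l' c * snd c) < 0"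
    using insert.IH[OF fin(3) infeasible] by blast
  have combination: "\<exists>\<mu>. (\<forall>c\<in>C. \<mu> c \<ge> 0) \<and> (\<forall>i. fst c' i = (\<Sum>c\<in>C. \<mu> c * fst c i)) \<and> snd c' = (\<Sum>c\<in>C. \<mu> c * snd c)"
    if "c' \<in> C'" for c'
  proof -
    have single: "(\<Sum>c\<in>C. of_bool (c = d) * h c) = h d" if "d \<in> C" for d and h :: "_ \<Rightarrow> real"
      using that insert.prems(1) by (subst sum.remove[of _ d]) (auto intro!: sum.neutral)
    from that consider "c' \<in> C" | c d where "c \<in> P" "d \<in> N" "c' = comb (c, d)"
      by (auto simp: C'_def)
    then show ?thesis
    proof cases
      case 1
      then show ?thesis by (intro exI[of _ "\<lambda>c. of_bool (c = c')"]) (simp add: single)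
    next
      case 2
      then have cd: "c \<in> C" "d \<in> C" "fst c y > 0" "fst d y < 0" by (auto simp: P_def N_def)
      have "(\<Sum>e\<in>C. (- fst d y * of_bool (e = c) + fst c y * of_bool (e = d)) * h e)
          = - fst d y * h c + fst c y * h d" for h
        by (simp only: distrib_right mult.assoc sum.distrib sum_distrib_left[symmetric] single cd)
      then show ?thesis using cd
        by (intro exI[of _ "\<lambda>e. - fst d y * of_bool (e = c) + fst c y * of_bool (e = d)"])
          (simp only: 2(3) comb_def split_conv fst_conv snd_conv, auto)
    qed
  qed
  have "\<forall>c'\<in>C'. \<exists>\<mu>. (\<forall>c\<in>C. \<mu> c \<ge> 0) \<and> (\<forall>i. fst c' i = (\<Sum>c\<in>C. \<mu> c * fst c i))
      \<and> snd c' = (\<Sum>c\<in>C. \<mu> c * snd c)"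
    by (intro ballI combination)
  from bchoice[OF this] obtain \<mu> where \<mu>': "\<forall>c'\<in>C'. (\<forall>c\<in>C. \<mu> c' c \<ge> 0)
      \<and> (\<forall>i. fst c' i = (\<Sum>c\<in>C. \<mu> c' c * fst c i)) \<and> snd c' = (\<Sum>c\<in>C. \<mu> c' c * snd c)" ..
  then have \<mu>: "\<And>c' c. c' \<in> C' \<Longrightarrow> c \<in> C \<Longrightarrow> \<mu> c' c \<ge> 0"
    "\<And>c' i. c' \<in> C' \<Longrightarrow> fst c' i = (\<Sum>c\<in>C. \<mu> c' c * fst c i)"
    "\<And>c'. c' \<in> C' \<Longrightarrow> snd c' = (\<Sum>c\<in>C. \<mu> c' c * snd c)"
    by blast+
  define l where "l = (\<lambda>c. \<Sum>c'\<in>C'. l' c' * \<mu> c' c)"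
  have swap: "(\<Sum>c\<in>C. l c * h c) = (\<Sum>c'\<in>C'. l' c' * (\<Sum>c\<in>C. \<mu> c' c * h c))" for h
    unfolding l_def sum_distrib_right sum_distrib_left mult.assoc by (rule sum.swap)
  have comb: "(\<Sum>c\<in>C. l c * fst c i) = (\<Sum>c'\<in>C'. l' c' * fst c' i)" for i
    unfolding swap by (intro sum.cong) (auto simp: \<mu>(2)[symmetric])
  have zero: "fst c' y = 0" if "c' \<in> C'" for c'
    using that by (auto simp: C'_def comb_def)
  show ?case
  proof (intro exI[of _ l] conjI ballI)
    show "l c \<ge> 0" if "c \<in> C" for c
      unfolding l_def using l'(1) \<mu>(1) that by (intro sum_nonneg mult_nonneg_nonneg) auto
    show "(\<Sum>c\<in>C. l c * fst c i) = 0" if "i \<in> insert y X" for i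
      unfolding comb using that l'(2) by (cases "i = y") (simp_all add: zero)
    have "(\<Sum>c\<in>C. l c * snd c) = (\<Sum>c'\<in>C'. l' c' * snd c')"
      unfolding swap by (intro sum.cong) (auto simp: \<mu>(3)[symmetric])
    then show "(\<Sum>c\<in>C. l c * snd c) < 0" using l'(3) by simp
  qed
qed

text \<open>Different indices may carry the same constraint. Each constraint gets one representative
  index, which receives its whole multiplier; all other indices get 0.\<close>

lemma farkas:
  fixes a :: "'k \<Rightarrow> 'v \<Rightarrow> real"
  assumes X: "finite X" and K: "finite K" and infeasible: "\<And>x. \<exists>k\<in>K. (\<Sum>i\<in>X. a k i * x i) > b k"
  shows "\<exists>l. (\<forall>k\<in>K. l k \<ge> 0) \<and> (\<forall>i\<in>X. (\<Sum>k\<in>K. l k * a k i) = 0) \<and> (\<Sum>k\<in>K. l k * b k) < 0"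
proof -
  define h where "h = (\<lambda>k. (a k, b k))"
  define g where "g = inv_into K h"
  have g: "g c \<in> K" "h (g c) = c" if "c \<in> h ` K" for c
    using that unfolding g_def by (auto intro: inv_into_into f_inv_into_f)
  obtain l where l: "\<And>c. c \<in> h ` K \<Longrightarrow> l c \<ge> 0" "\<And>i. i \<in> X \<Longrightarrow> (\<Sum>c\<in>h ` K. l c * fst c i) = 0"
    "(\<Sum>c\<in>h ` K. l c * snd c) < 0"
  proof -
    have "\<exists>c\<in>h ` K. (\<Sum>i\<in>X. fst c i * x i) > snd c" for x
      using infeasible[of x] by (auto simp: h_def)
    then show ?thesis using farkas_set[OF X finite_imageI[OF K, of h]] that by blast
  qed
  have inj: "inj_on g (h ` K)" using g(2) by (metis inj_onI)
  define l' where "l' = (\<lambda>k. if k \<in> g ` h ` K then l (h k) else 0)"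
  have sum: "(\<Sum>k\<in>K. l' k * F (h k)) = (\<Sum>c\<in>h ` K. l c * F c)" for F
  proof -
    have "(\<Sum>k\<in>K. l' k * F (h k)) = (\<Sum>k\<in>g ` h ` K. l (h k) * F (h k))"
      using K g(1) by (intro sum.mono_neutral_cong_right) (auto simp: l'_def)
    also have "\<dots> = (\<Sum>c\<in>h ` K. l (h (g c)) * F (h (g c)))"
      by (subst sum.reindex) (simp_all add: inj)
    also have "\<dots> = (\<Sum>c\<in>h ` K. l c * F c)" using g(2) by (intro sum.cong) auto
    finally show ?thesis .
  qed
  show ?thesis
  proof (intro exI[of _ l'] conjI ballI)
    show "l' k \<ge> 0" if "k \<in> K" for k
      using l(1)[of "h k"] that by (simp add: l'_def)
    show "(\<Sum>k\<in>K. l' k * a k i) = 0" if "i \<in> X" for i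
      using sum[of "\<lambda>c. fst c i"] l(2)[OF that] by (simp only: h_def fst_conv)
    show "(\<Sum>k\<in>K. l' k * b k) < 0"
      using sum[of snd] l(3) by (simp only: h_def snd_conv)
  qed
qed

section \<open>Circulations in a directed hypergraph and their linear program\<close>

lemma sum_of_bool_eq:
  fixes f :: "'a \<Rightarrow> real"
  assumes "finite A" "a \<in> A"
  shows "(\<Sum>u\<in>A. of_bool (u = a) * f u) = f a"
  using assms by (subst sum.remove[of _ a]) (auto intro!: sum.neutral)

text \<open>Translates between a flow on vertex pairs and its hyperedge components; \<open>h\<close>
  will be a distance, a net-flow coefficient or the indicator of crossing a cut.\<close>

lemma sum_pairs_edges:
  fixes Fe :: "nat \<Rightarrow> nat \<Rightarrow> nat \<Rightarrow> real"
  assumes E: "finite E" "\<And>e. e \<in> E \<Longrightarrow> Hd e \<subseteq> {..<n} \<and> Tl e \<subseteq> {..<n}"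
  shows "(\<Sum>i<n. \<Sum>j<n. (\<Sum>e\<in>{e\<in>E. i \<in> Hd e \<and> j \<in> Tl e}. Fe e i j) * h i j)
       = (\<Sum>e\<in>E. \<Sum>i\<in>Hd e. \<Sum>j\<in>Tl e. Fe e i j * h i j)"
proof -
  let ?g = "\<lambda>e i j. if i \<in> Hd e then if j \<in> Tl e then Fe e i j * h i j else 0 else 0"
  have "(\<Sum>i<n. \<Sum>j<n. (\<Sum>e\<in>{e\<in>E. i \<in> Hd e \<and> j \<in> Tl e}. Fe e i j) * h i j)
      = (\<Sum>i<n. \<Sum>j<n. \<Sum>e\<in>E. ?g e i j)"
    using E(1) by (intro sum.cong refl) (auto simp: sum_distrib_right sum.inter_filter intro!: sum.cong)
  also have "\<dots> = (\<Sum>i<n. \<Sum>e\<in>E. \<Sum>j<n. ?g e i j)"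
    by (intro sum.cong refl sum.swap)
  also have "\<dots> = (\<Sum>e\<in>E. \<Sum>i<n. \<Sum>j<n. ?g e i j)" by (rule sum.swap)
  also have "\<dots> = (\<Sum>e\<in>E. \<Sum>i\<in>Hd e. \<Sum>j\<in>Tl e. Fe e i j * h i j)"
  proof (rule sum.cong[OF refl])
    fix e assume "e \<in> E"
    note e = E(2)[OF this]
    have "(\<Sum>i<n. \<Sum>j<n. ?g e i j) = (\<Sum>i\<in>Hd e. \<Sum>j<n. ?g e i j)"
      using e by (intro sum.mono_neutral_right) auto
    also have "\<dots> = (\<Sum>i\<in>Hd e. \<Sum>j\<in>Tl e. Fe e i j * h i j)"
      using e by (intro sum.cong refl sum.mono_neutral_cong_right) auto
    finally show "(\<Sum>i<n. \<Sum>j<n. ?g e i j) = (\<Sum>i\<in>Hd e. \<Sum>j\<in>Tl e. Fe e i j * h i j)" .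
  qed
  finally show ?thesis .
qed

lemma sqdist_commute: "sqdist n x y = sqdist n y x"
  unfolding sqdist_def by (intro sum.cong refl) (simp add: power2_commute)

lemma sqdist_self [simp]: "sqdist n x x = 0"
  by (simp add: sqdist_def)

lemma sqdist_nonneg: "sqdist n x y \<ge> 0"
  by (simp add: sqdist_def sum_nonneg)

text \<open>Symmetry and the zero diagonal of the distance undo the symmetrisation of
  \<open>F\<close>. The remaining \<open>1 / 2\<close> is the one in the dual constraint
  \<open>sqdist n (v i) (v j) / 2 + \<rho> j - \<rho> i \<le> q e\<close>.\<close>

lemma sdp_objective_eq: "sdp_objective n F v = (\<Sum>i<n. \<Sum>j<n. F i j * sqdist n (v i) (v j)) / 2"
proof -
  have "(\<Sum>j<m. \<Sum>i<j. (F i j + F j i) / 2 * d i j) = (\<Sum>i<m. \<Sum>j<m. F i j * d i j) / 2"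
    if "\<And>i j. d i j = d j i" "\<And>i. d i i = 0" for m and d :: "nat \<Rightarrow> nat \<Rightarrow> real"
  proof (induction m)
    case (Suc m)
    have "(\<Sum>i<m. (F i m + F m i) / 2 * d i m) = ((\<Sum>i<m. F i m * d i m) + (\<Sum>i<m. F m i * d m i)) / 2"
      unfolding sum.distrib[symmetric] sum_divide_distrib
      by (intro sum.cong refl) (simp add: that(1)[of m] field_simps)
    then show ?case using Suc that by (simp add: sum.distrib add_divide_distrib)
  qed simp
  then show ?thesis unfolding sdp_objective_def by (simp add: sqdist_commute)
qed

lemma flow_objective:
  assumes wf: "dhg_wf n E Hd Tl w vw"
    and F: "F = (\<lambda>i j. \<Sum>e\<in>{e\<in>E. i \<in> Hd e \<and> j \<in> Tl e}. Fe e i j)"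
  shows "sdp_objective n F v = (\<Sum>e\<in>E. \<Sum>i\<in>Hd e. \<Sum>j\<in>Tl e. Fe e i j * sqdist n (v i) (v j)) / 2"
  unfolding sdp_objective_eq F using wf by (subst sum_pairs_edges) (auto simp: dhg_wf_def)

text \<open>Makes the real supremum over all flows an actual upper bound.\<close>

lemma objective_bdd_above:
  assumes wf: "dhg_wf n E Hd Tl w vw"
  shows "bdd_above ((\<lambda>F. sdp_objective n F v) ` flows n E Hd Tl w)"
proof (rule bdd_aboveI2)
  fix F assume "F \<in> flows n E Hd Tl w"
  then obtain Fe where Fe: "\<forall>e\<in>E. \<forall>i\<in>Hd e. \<forall>j\<in>Tl e. Fe e i j \<ge> 0"
    "\<forall>e\<in>E. (\<Sum>i\<in>Hd e. \<Sum>j\<in>Tl e. Fe e i j) \<le> w e"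
    "F = (\<lambda>i j. \<Sum>e\<in>{e\<in>E. i \<in> Hd e \<and> j \<in> Tl e}. Fe e i j)"
    by (auto simp: flows_def)
  define B where "B = (\<Sum>i<n. \<Sum>j<n. sqdist n (v i) (v j))"
  have B: "sqdist n (v i) (v j) \<le> B" if "i < n" "j < n" for i j
  proof -
    have "sqdist n (v i) (v j) \<le> (\<Sum>j<n. sqdist n (v i) (v j))"
      using that by (intro member_le_sum) (auto simp: sqdist_nonneg)
    also have "\<dots> \<le> B"
      unfolding B_def using that by (intro member_le_sum[of i]) (auto simp: sqdist_nonneg sum_nonneg)
    finally show ?thesis .
  qed
  have B0: "B \<ge> 0" unfolding B_def by (intro sum_nonneg sqdist_nonneg)
  have "(\<Sum>e\<in>E. \<Sum>i\<in>Hd e. \<Sum>j\<in>Tl e. Fe e i j * sqdist n (v i) (v j))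
      \<le> (\<Sum>e\<in>E. \<Sum>i\<in>Hd e. \<Sum>j\<in>Tl e. Fe e i j * B)"
    using wf Fe(1) by (intro sum_mono mult_left_mono B) (auto simp: dhg_wf_def)
  also have "\<dots> \<le> (\<Sum>e\<in>E. w e * B)"
    unfolding sum_distrib_right[symmetric] using Fe(2) B0 by (intro mult_right_mono sum_mono) auto
  finally show "sdp_objective n F v \<le> (\<Sum>e\<in>E. w e * B) / 2"
    unfolding flow_objective[OF wf Fe(3)] by simp
qed

lemma zero_flow:
  assumes wf: "dhg_wf n E Hd Tl w vw"
  shows "(\<lambda>_ _. 0) \<in> flows n E Hd Tl w"
  using wf unfolding flows_def dhg_wf_def by (auto intro!: exI[of _ "\<lambda>_ _ _. 0"] less_imp_le)

text \<open>The potential \<open>\<rho>\<close> is dual to conservation and \<open>q\<close> to the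
  capacities. Farkas' lemma is applied to the dual system: if it is infeasible, the multipliers of
  the pair constraints form a circulation, and dividing by the multiplier of the budget constraint
  gives a flow with objective above \<open>M\<close>.\<close>

lemma flow_duality:
  assumes wf: "dhg_wf n E Hd Tl w vw"
    and M: "\<And>F. F \<in> flows n E Hd Tl w \<Longrightarrow> sdp_objective n F v \<le> M"
  shows "\<exists>\<rho> q. (\<forall>e\<in>E. q e \<ge> 0)
    \<and> (\<forall>e\<in>E. \<forall>i\<in>Hd e. \<forall>j\<in>Tl e. sqdist n (v i) (v j) / 2 + \<rho> j - \<rho> i \<le> q e)
    \<and> (\<Sum>e\<in>E. w e * q e) \<le> M"
proof (rule ccontr)
  assume no: "\<not> ?thesis"
  have E: "finite E" and sub: "\<And>e. e \<in> E \<Longrightarrow> Hd e \<subseteq> {..<n} \<and> Tl e \<subseteq> {..<n}"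
    and w: "\<And>e. e \<in> E \<Longrightarrow> w e > 0"
    using wf by (auto simp: dhg_wf_def)
  have finHT: "finite (Hd e)" "finite (Tl e)" if "e \<in> E" for e
    using sub[OF that] by (auto intro: finite_subset)
  define X :: "(nat + nat) set" where "X = {..<n} <+> E"
  define K :: "(nat \<times> nat \<times> nat + nat + unit) set"
    where "K = (SIGMA e:E. Hd e \<times> Tl e) <+> (E <+> {()})"
  define a :: "nat \<times> nat \<times> nat + nat + unit \<Rightarrow> nat + nat \<Rightarrow> real" where
    "a = (\<lambda>k x. case k of
        Inl (e, i, j) \<Rightarrow> (case x of Inl u \<Rightarrow> of_bool (u = j) - of_bool (u = i) | Inr e' \<Rightarrow> - of_bool (e' = e))
      | Inr (Inl e) \<Rightarrow> (case x of Inl u \<Rightarrow> 0 | Inr e' \<Rightarrow> - of_bool (e' = e))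
      | Inr (Inr _) \<Rightarrow> (case x of Inl u \<Rightarrow> 0 | Inr e' \<Rightarrow> w e'))"
  define b :: "nat \<times> nat \<times> nat + nat + unit \<Rightarrow> real" where
    "b = (\<lambda>k. case k of Inl (e, i, j) \<Rightarrow> - sqdist n (v i) (v j) / 2 | Inr (Inl e) \<Rightarrow> 0 | Inr (Inr _) \<Rightarrow> M)"
  have finX: "finite X" and finK: "finite K"
    using E finHT by (auto simp: X_def K_def intro!: finite_Plus finite_SigmaI)
  have sumX: "(\<Sum>x\<in>X. g x) = (\<Sum>u<n. g (Inl u)) + (\<Sum>e\<in>E. g (Inr e))" for g :: "_ \<Rightarrow> real"
    unfolding X_def using E by (simp add: sum.Plus)
  have sumK: "(\<Sum>k\<in>K. g k) = (\<Sum>e\<in>E. \<Sum>i\<in>Hd e. \<Sum>j\<in>Tl e. g (Inl (e, i, j)))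
      + (\<Sum>e\<in>E. g (Inr (Inl e))) + g (Inr (Inr ()))" for g :: "_ \<Rightarrow> real"
  proof -
    have "(\<Sum>k\<in>(SIGMA e:E. Hd e \<times> Tl e). g (Inl k)) = (\<Sum>e\<in>E. \<Sum>i\<in>Hd e. \<Sum>j\<in>Tl e. g (Inl (e, i, j)))"
    proof -
      have "(\<Sum>e\<in>E. \<Sum>i\<in>Hd e. \<Sum>j\<in>Tl e. g (Inl (e, i, j))) = (\<Sum>e\<in>E. \<Sum>k\<in>Hd e \<times> Tl e. g (Inl (e, k)))"
        by (intro sum.cong refl) (simp add: sum.cartesian_product case_prod_unfold)
      also have "\<dots> = (\<Sum>k\<in>(SIGMA e:E. Hd e \<times> Tl e). g (Inl k))"
        using E finHT by (subst sum.Sigma) (auto simp: case_prod_unfold)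
      finally show ?thesis ..
    qed
    then show ?thesis
      unfolding K_def using E finHT by (subst sum.Plus) (auto simp: sum.Plus intro!: finite_SigmaI)
  qed
  have K_iff: "Inl (e, i, j) \<in> K \<longleftrightarrow> e \<in> E \<and> i \<in> Hd e \<and> j \<in> Tl e" "Inr (Inl e) \<in> K \<longleftrightarrow> e \<in> E"
    "Inr (Inr ()) \<in> K" for e i j
    by (auto simp: K_def)
  have X_iff: "Inl u \<in> X \<longleftrightarrow> u < n" "Inr e \<in> X \<longleftrightarrow> e \<in> E" for u e
    by (auto simp: X_def)
  have "\<exists>k\<in>K. (\<Sum>x\<in>X. a k x * y x) > b k" for y
  proof (rule ccontr)
    assume "\<not> ?thesis"
    then have y: "(\<Sum>u<n. a k (Inl u) * y (Inl u)) + (\<Sum>e\<in>E. a k (Inr e) * y (Inr e)) \<le> b k"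
      if "k \<in> K" for k
      using that unfolding sumX by force
    have "y (Inr e) \<ge> 0" if "e \<in> E" for e
      using y[of "Inr (Inl e)"] that E by (simp add: K_iff a_def b_def sum_negf sum_of_bool_eq)
    moreover have "sqdist n (v i) (v j) / 2 + y (Inl j) - y (Inl i) \<le> y (Inr e)"
      if e: "e \<in> E" "i \<in> Hd e" "j \<in> Tl e" for e i j
    proof -
      have "i < n" "j < n" using sub[OF e(1)] e by auto
      then show ?thesis
        using y[of "Inl (e, i, j)"] e E
        by (simp add: K_iff a_def b_def sum_negf sum_of_bool_eq left_diff_distrib sum_subtractf)
    qed
    moreover have "(\<Sum>e\<in>E. w e * y (Inr e)) \<le> M"
      using y[of "Inr (Inr ())"] by (simp add: K_iff a_def b_def)
    ultimately have "(\<forall>e\<in>E. y (Inr e) \<ge> 0)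
        \<and> (\<forall>e\<in>E. \<forall>i\<in>Hd e. \<forall>j\<in>Tl e. sqdist n (v i) (v j) / 2 + y (Inl j) - y (Inl i) \<le> y (Inr e))
        \<and> (\<Sum>e\<in>E. w e * y (Inr e)) \<le> M"
      by simp
    with no[unfolded not_ex, THEN spec, THEN spec, of "\<lambda>e. y (Inr e)" "\<lambda>u. y (Inl u)"] show False
      by (rule notE)
  qed
  from farkas[OF finX finK this] obtain l where l: "\<And>k. k \<in> K \<Longrightarrow> l k \<ge> 0"
    "\<And>x. x \<in> X \<Longrightarrow> (\<Sum>k\<in>K. l k * a k x) = 0" "(\<Sum>k\<in>K. l k * b k) < 0"
    by blast
  define f where "f = (\<lambda>e i j. l (Inl (e, i, j)))"
  define z where "z = l (Inr (Inr ()))"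
  have f: "f e i j \<ge> 0" if "e \<in> E" "i \<in> Hd e" "j \<in> Tl e" for e i j
    unfolding f_def using that by (intro l(1)) (auto simp: K_iff)
  have z: "z \<ge> 0" unfolding z_def by (intro l(1)) (auto simp: K_iff)
  have conserve: "(\<Sum>e\<in>E. \<Sum>i\<in>Hd e. \<Sum>j\<in>Tl e. f e i j * (of_bool (j = u) - of_bool (i = u))) = 0" if "u < n" for u
    using l(2)[of "Inl u"] that by (simp add: sumK X_iff a_def f_def eq_commute[of u])
  have capacity: "(\<Sum>i\<in>Hd e. \<Sum>j\<in>Tl e. f e i j) \<le> z * w e" if e: "e \<in> E" for e
  proof -
    have "(\<Sum>e'\<in>E. \<Sum>i\<in>Hd e'. \<Sum>j\<in>Tl e'. f e' i j * of_bool (e = e'))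
        = (\<Sum>e'\<in>E. of_bool (e' = e) * (\<Sum>i\<in>Hd e'. \<Sum>j\<in>Tl e'. f e' i j))"
      by (auto intro!: sum.cong simp: sum_distrib_left mult.commute)
    moreover have "(\<Sum>e'\<in>E. l (Inr (Inl e')) * of_bool (e = e')) = (\<Sum>e'\<in>E. of_bool (e' = e) * l (Inr (Inl e')))"
      by (auto intro!: sum.cong)
    moreover have "l (Inr (Inl e)) \<ge> 0" using e by (intro l(1)) (auto simp: K_iff)
    ultimately show ?thesis
      using l(2)[of "Inr e"] e E
      by (simp add: sumK X_iff a_def f_def z_def sum_negf sum_of_bool_eq)
  qed
  have gain: "z * M < (\<Sum>e\<in>E. \<Sum>i\<in>Hd e. \<Sum>j\<in>Tl e. f e i j * sqdist n (v i) (v j)) / 2"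
    using l(3) by (simp add: sumK b_def f_def z_def sum_negf sum_divide_distrib)
  show False
  proof (cases "z = 0")
    \<comment> \<open>With a zero multiplier on the budget all capacities vanish, so the circulation
      is zero and cannot have positive gain.\<close>
    case True
    have "f e i j = 0" if e: "e \<in> E" "i \<in> Hd e" "j \<in> Tl e" for e i j
    proof -
      have "f e i j \<le> (\<Sum>j\<in>Tl e. f e i j)"
        using e f finHT by (intro member_le_sum) auto
      also have "\<dots> \<le> (\<Sum>i\<in>Hd e. \<Sum>j\<in>Tl e. f e i j)"
        using e f finHT by (intro member_le_sum[of i]) (auto intro!: sum_nonneg)
      also have "\<dots> \<le> 0" using capacity[OF e(1)] True by simp
      finally show ?thesis using f[OF e] by simp
    qed
    then show False using gain True by simp
  next
    case False
    then have z: "z > 0" using z by simp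
    define Fe where "Fe = (\<lambda>e i j. f e i j / z)"
    define F where "F = (\<lambda>i j. \<Sum>e\<in>{e\<in>E. i \<in> Hd e \<and> j \<in> Tl e}. Fe e i j)"
    have "(\<Sum>i<n. F i u) = (\<Sum>k<n. F u k)" if u: "u < n" for u
    proof -
      have "(\<Sum>i<n. \<Sum>j<n. F i j * (of_bool (j = u) - of_bool (i = u)))
          = (\<Sum>e\<in>E. \<Sum>i\<in>Hd e. \<Sum>j\<in>Tl e. f e i j * (of_bool (j = u) - of_bool (i = u))) / z"
        unfolding F_def Fe_def by (subst sum_pairs_edges[OF E sub]) (auto simp: sum_divide_distrib)
      then have "(\<Sum>i<n. \<Sum>j<n. F i j * (of_bool (j = u) - of_bool (i = u))) = 0"
        using conserve[OF u] by simp
      moreover have "(\<Sum>j<n. F i j * of_bool (j = u)) = F i u" for i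
        using sum_of_bool_eq[of "{..<n}" u "F i"] u by (simp add: mult.commute)
      moreover have "(\<Sum>i<n. (\<Sum>j<n. F i j) * of_bool (i = u)) = (\<Sum>j<n. F u j)"
        using sum_of_bool_eq[of "{..<n}" u "\<lambda>i. \<Sum>j<n. F i j"] u by (simp add: mult.commute)
      ultimately show ?thesis
        by (simp add: right_diff_distrib sum_subtractf sum_distrib_right)
    qed
    moreover have "(\<Sum>i\<in>Hd e. \<Sum>j\<in>Tl e. Fe e i j) \<le> w e" if "e \<in> E" for e
      using capacity[OF that] z unfolding Fe_def sum_divide_distrib[symmetric] by (simp add: field_simps)
    ultimately have "F \<in> flows n E Hd Tl w"
      unfolding flows_def using f z by (auto intro!: exI[of _ Fe] simp: F_def Fe_def)
    then have "sdp_objective n F v \<le> M" by (rule M)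
    then have "(\<Sum>e\<in>E. \<Sum>i\<in>Hd e. \<Sum>j\<in>Tl e. Fe e i j * sqdist n (v i) (v j)) / 2 \<le> M"
      unfolding flow_objective[OF wf F_def] .
    moreover have "(\<Sum>e\<in>E. \<Sum>i\<in>Hd e. \<Sum>j\<in>Tl e. Fe e i j * sqdist n (v i) (v j))
        = (\<Sum>e\<in>E. \<Sum>i\<in>Hd e. \<Sum>j\<in>Tl e. f e i j * sqdist n (v i) (v j)) / z"
      by (simp add: Fe_def sum_divide_distrib)
    ultimately show False using gain z by (simp add: field_simps)
  qed
qed

section \<open>Threshold rounding\<close>

lemma lborel_Ico_indicator:
  "has_bochner_integral lborel (indicat_real {a..<b}) (max 0 (b - a))" for a b :: real
proof (cases "a \<le> b")
  case True
  then show ?thesis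
    using has_bochner_integral_real_indicator[of "{a..<b}" lborel] by (simp add: max_def)
next
  case False
  then have "indicat_real {a..<b} = (\<lambda>_. 0)" by (auto simp: indicator_def)
  then show ?thesis using False by (simp add: max_def has_bochner_integral_zero)
qed

text \<open>The level inequality is integrated over \<open>t \<ge> 0\<close>. A vertex contributes
  an interval of length \<open>f i\<close>; a hyperedge is cut exactly for \<open>t\<close> between
  the least value on \<open>A e\<close> and the greatest on \<open>B e\<close>, an interval of
  length at most \<open>q e\<close>. Tails and heads take the roles of \<open>A\<close> and
  \<open>B\<close> in either order.\<close>

lemma layer_cake_le:
  fixes f :: "'a \<Rightarrow> real"
  assumes V: "finite V" "\<And>i. i \<in> V \<Longrightarrow> f i \<ge> 0" and E: "finite E"
    and w: "\<And>e. e \<in> E \<Longrightarrow> w e \<ge> 0" and q: "\<And>e. e \<in> E \<Longrightarrow> q e \<ge> 0"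
    and AB: "\<And>e. e \<in> E \<Longrightarrow> A e \<subseteq> V \<and> B e \<subseteq> V"
    and step: "\<And>e i j. e \<in> E \<Longrightarrow> i \<in> B e \<Longrightarrow> j \<in> A e \<Longrightarrow> f i \<le> f j + q e"
    and level: "\<And>t. t \<ge> 0 \<Longrightarrow> c * sum p {i\<in>V. f i > t}
      \<le> sum w {e\<in>E. (\<exists>j\<in>A e. f j \<le> t) \<and> (\<exists>i\<in>B e. f i > t)}"
  shows "c * (\<Sum>i\<in>V. p i * f i) \<le> (\<Sum>e\<in>E. w e * q e)"
proof -
  \<comment> \<open>If a side is empty the hyperedge is never cut, and the default 0 for both ends
    gives an empty interval.\<close>
  define \<alpha> where "\<alpha> = (\<lambda>e. if A e = {} \<or> B e = {} then 0 else Min (f ` A e))"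
  define \<beta> where "\<beta> = (\<lambda>e. if A e = {} \<or> B e = {} then 0 else Max (f ` B e))"
  have fin: "finite (A e)" "finite (B e)" if "e \<in> E" for e
    using AB[OF that] V(1) by (auto intro: finite_subset)
  have crossing: "(\<exists>j\<in>A e. f j \<le> t) \<and> (\<exists>i\<in>B e. f i > t) \<longleftrightarrow> \<alpha> e \<le> t \<and> t < \<beta> e" if e: "e \<in> E" for e t
  proof (cases "A e = {} \<or> B e = {}")
    case False
    then show ?thesis using fin[OF e] by (simp add: \<alpha>_def \<beta>_def Min_le_iff Max_gr_iff)
  qed (auto simp: \<alpha>_def \<beta>_def)
  have \<alpha>0: "\<alpha> e \<ge> 0" if e: "e \<in> E" for e
    using fin[OF e] AB[OF e] V(2) by (auto simp: \<alpha>_def)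
  have width: "max 0 (\<beta> e - \<alpha> e) \<le> q e" if e: "e \<in> E" for e
  proof (cases "A e = {} \<or> B e = {}")
    case False
    then have "Min (f ` A e) \<in> f ` A e" "Max (f ` B e) \<in> f ` B e"
      using fin[OF e] by (auto intro!: Min_in Max_in)
    then obtain j i where "j \<in> A e" "i \<in> B e" "\<alpha> e = f j" "\<beta> e = f i"
      using False by (auto simp: \<alpha>_def \<beta>_def)
    then show ?thesis using step[OF e, of i j] q[OF e] by simp
  qed (use q[OF e] in \<open>auto simp: \<alpha>_def \<beta>_def\<close>)
  let ?g = "\<lambda>t. c * (\<Sum>i\<in>V. p i * indicat_real {0..<f i} t)"
  let ?h = "\<lambda>t. \<Sum>e\<in>E. w e * indicat_real {\<alpha> e..<\<beta> e} t"
  have g: "has_bochner_integral lborel ?g (c * (\<Sum>i\<in>V. p i * max 0 (f i - 0)))"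
    by (intro has_bochner_integral_mult_right has_bochner_integral_sum lborel_Ico_indicator)
  have h: "has_bochner_integral lborel ?h (\<Sum>e\<in>E. w e * max 0 (\<beta> e - \<alpha> e))"
    by (intro has_bochner_integral_mult_right has_bochner_integral_sum lborel_Ico_indicator)
  have "?g t \<le> ?h t" for t
  proof (cases "t \<ge> 0")
    case True
    have "(\<Sum>i\<in>V. p i * indicat_real {0..<f i} t) = sum p {i\<in>V. f i > t}"
      unfolding sum.inter_filter[OF V(1)] using True by (intro sum.cong) (auto simp: indicator_def)
    moreover have "?h t = sum w {e\<in>E. \<alpha> e \<le> t \<and> t < \<beta> e}"
      unfolding sum.inter_filter[OF E] by (intro sum.cong) (auto simp: indicator_def)
    moreover have "{e\<in>E. \<alpha> e \<le> t \<and> t < \<beta> e} = {e\<in>E. (\<exists>j\<in>A e. f j \<le> t) \<and> (\<exists>i\<in>B e. f i > t)}"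
      using crossing by blast
    ultimately show ?thesis using level[OF True] by simp
  next
    case False
    then show ?thesis using w by (simp add: sum_nonneg)
  qed
  then have "integral\<^sup>L lborel ?g \<le> integral\<^sup>L lborel ?h"
    using g h by (intro integral_mono) (auto simp: has_bochner_integral_iff)
  then have "c * (\<Sum>i\<in>V. p i * max 0 (f i - 0)) \<le> (\<Sum>e\<in>E. w e * max 0 (\<beta> e - \<alpha> e))"
    using g h by (simp only: has_bochner_integral_iff)
  also have "\<dots> \<le> (\<Sum>e\<in>E. w e * q e)"
    using width w by (intro sum_mono mult_left_mono)
  finally show ?thesis using V(2) by simp
qed

section \<open>Cuts and expansion of a fixed hypergraph\<close>

context
  fixes n :: nat and E :: "nat set" and Hd Tl :: "nat \<Rightarrow> nat set" and w vw :: "nat \<Rightarrow> real"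
  assumes n: "n \<ge> 2" and wf: "dhg_wf n E Hd Tl w vw"
begin

lemma sum_weights_pos: "S \<noteq> {} \<Longrightarrow> S \<subseteq> {..<n} \<Longrightarrow> sum vw S > 0"
  using wf by (intro sum_pos) (auto simp: dhg_wf_def intro: finite_subset)

lemma dir_expansion_attained:
  "\<exists>S. S \<noteq> {} \<and> S \<subset> {..<n} \<and> dir_expansion n E Hd Tl w vw = dir_expansion_set n E Hd Tl w vw S"
proof -
  have "0 \<in> {..<n}" "1 \<in> {..<n} - {0}" using n by simp_all
  then have "{0} \<in> {S. S \<noteq> {} \<and> S \<subset> {..<n}}" by blast
  then have "dir_expansion n E Hd Tl w vw
      \<in> (\<lambda>S. dir_expansion_set n E Hd Tl w vw S) ` {S. S \<noteq> {} \<and> S \<subset> {..<n}}"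
    unfolding dir_expansion_def
    by (intro Min_in finite_imageI) (auto intro: finite_subset[of _ "Pow {..<n}"])
  then show ?thesis by auto
qed

lemma dir_expansion_nonneg: "dir_expansion n E Hd Tl w vw \<ge> 0"
proof -
  obtain S where S: "S \<noteq> {}" "S \<subset> {..<n}"
    "dir_expansion n E Hd Tl w vw = dir_expansion_set n E Hd Tl w vw S"
    using dir_expansion_attained by blast
  have "sum vw S > 0" "sum vw ({..<n} - S) > 0"
    using S by (auto intro!: sum_weights_pos)
  moreover have "sum w (delta_out n E Hd Tl X) \<ge> 0" for X
    using wf by (intro sum_nonneg) (auto simp: delta_out_def dhg_wf_def less_imp_le)
  ultimately show ?thesis unfolding S(3) dir_expansion_set_def by simp
qed

lemma dir_expansion_mult_le:
  assumes "S \<noteq> {}" "S \<subset> {..<n}"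
  shows "dir_expansion n E Hd Tl w vw * min (sum vw S) (sum vw ({..<n} - S))
    \<le> min (sum w (delta_out n E Hd Tl S)) (sum w (delta_out n E Hd Tl ({..<n} - S)))"
proof -
  have "dir_expansion n E Hd Tl w vw \<le> dir_expansion_set n E Hd Tl w vw S"
    unfolding dir_expansion_def using assms
    by (intro Min_le finite_imageI imageI) (auto intro: finite_subset[of _ "Pow {..<n}"])
  moreover have "sum vw S > 0" "sum vw ({..<n} - S) > 0"
    using assms by (auto intro!: sum_weights_pos)
  ultimately show ?thesis by (simp add: dir_expansion_set_def pos_le_divide_eq)
qed

text \<open>Level sets at \<open>t \<ge> 0\<close> avoid \<open>Z\<close>, so their complements keep
  a share \<open>c\<close> of the total weight and the smaller side weighs at least \<open>c\<close>
  times the level set. Either form of \<open>step\<close> suffices, as the expansion bounds both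
  boundaries of a level set from below.\<close>

lemma threshold_rounding:
  assumes Z: "Z \<subseteq> {..<n}" "sum vw Z \<ge> c * sum vw {..<n}" and c: "0 < c" "c \<le> 1"
    and f: "\<And>i. f i \<ge> 0" "\<And>i. i \<in> Z \<Longrightarrow> f i = 0" and q: "\<And>e. e \<in> E \<Longrightarrow> q e \<ge> 0"
    and step: "(\<forall>e\<in>E. \<forall>i\<in>Hd e. \<forall>j\<in>Tl e. f i \<le> f j + q e) \<or> (\<forall>e\<in>E. \<forall>i\<in>Hd e. \<forall>j\<in>Tl e. f j \<le> f i + q e)"
  shows "dir_expansion n E Hd Tl w vw * c * (\<Sum>i<n. vw i * f i) \<le> (\<Sum>e\<in>E. w e * q e)"
proof -
  let ?\<phi> = "dir_expansion n E Hd Tl w vw"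
  have E: "finite E" "\<And>e. e \<in> E \<Longrightarrow> Hd e \<subseteq> {..<n} \<and> Tl e \<subseteq> {..<n}" "\<And>e. e \<in> E \<Longrightarrow> w e \<ge> 0"
    using wf by (auto simp: dhg_wf_def less_imp_le)
  have vw: "\<And>i. i < n \<Longrightarrow> vw i \<ge> 0" using wf by (auto simp: dhg_wf_def less_imp_le)
  define T where "T = (\<lambda>t. {i\<in>{..<n}. f i > t})"
  have level: "?\<phi> * c * sum vw (T t)
      \<le> min (sum w (delta_out n E Hd Tl (T t))) (sum w (delta_out n E Hd Tl ({..<n} - T t)))" if t: "t \<ge> 0" for t
  proof (cases "T t = {}")
    case True
    then show ?thesis using E by (auto simp: delta_out_def intro!: sum_nonneg)
  next
    case False
    have ZT: "Z \<subseteq> {..<n} - T t" using Z f(2) t by (auto simp: T_def)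
    have "0 \<in> {..<n}" using n by simp
    then have "sum vw {..<n} > 0" by (intro sum_weights_pos) blast+
    then have "sum vw Z > 0" using Z(2) c(1) by (meson less_le_trans mult_pos_pos)
    then have "Z \<noteq> {}" by auto
    then have T: "T t \<subset> {..<n}" using ZT by (auto simp: T_def)
    have "c * sum vw (T t) \<le> c * sum vw {..<n}"
      using c vw by (intro mult_left_mono sum_mono2) (auto simp: T_def)
    also have "\<dots> \<le> sum vw ({..<n} - T t)"
      using Z(2) sum_mono2[of "{..<n} - T t" Z vw] ZT vw by force
    finally have "c * sum vw (T t) \<le> sum vw ({..<n} - T t)" .
    moreover have "c * sum vw (T t) \<le> 1 * sum vw (T t)"
      using c vw by (intro mult_right_mono sum_nonneg) (auto simp: T_def)
    ultimately have "?\<phi> * (c * sum vw (T t)) \<le> ?\<phi> * min (sum vw (T t)) (sum vw ({..<n} - T t))"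
      by (intro mult_left_mono dir_expansion_nonneg) simp
    then show ?thesis using dir_expansion_mult_le[OF False T] by (simp add: mult.assoc)
  qed
  from step show ?thesis
  proof
    assume step: "\<forall>e\<in>E. \<forall>i\<in>Hd e. \<forall>j\<in>Tl e. f i \<le> f j + q e"
    show ?thesis
    proof (rule layer_cake_le[where A = Tl and B = Hd])
      show "?\<phi> * c * sum vw {i\<in>{..<n}. f i > t} \<le> sum w {e\<in>E. (\<exists>j\<in>Tl e. f j \<le> t) \<and> (\<exists>i\<in>Hd e. f i > t)}"
        if "t \<ge> 0" for t
      proof -
        have "delta_out n E Hd Tl ({..<n} - T t) = {e\<in>E. (\<exists>j\<in>Tl e. f j \<le> t) \<and> (\<exists>i\<in>Hd e. f i > t)}"
          unfolding delta_out_def T_def using E(2) by (fastforce simp: not_less)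
        then show ?thesis using level[OF that] by (simp add: T_def)
      qed
    qed (use E f q step in auto)
  next
    assume step: "\<forall>e\<in>E. \<forall>i\<in>Hd e. \<forall>j\<in>Tl e. f j \<le> f i + q e"
    show ?thesis
    proof (rule layer_cake_le[where A = Hd and B = Tl])
      show "?\<phi> * c * sum vw {i\<in>{..<n}. f i > t} \<le> sum w {e\<in>E. (\<exists>j\<in>Hd e. f j \<le> t) \<and> (\<exists>i\<in>Tl e. f i > t)}"
        if "t \<ge> 0" for t
      proof -
        have "delta_out n E Hd Tl (T t) = {e\<in>E. (\<exists>j\<in>Hd e. f j \<le> t) \<and> (\<exists>i\<in>Tl e. f i > t)}"
          unfolding delta_out_def T_def using E(2) by (fastforce simp: not_less)
        then show ?thesis using level[OF that] by (simp add: T_def)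
      qed
    qed (use E f q step in auto)
  qed
qed

text \<open>The constant is \<open>2^32\<close> from the potential function times \<open>2^7\<close>
  from the weight share \<open>1 / 128\<close> of \<open>Z\<close>. Allowing any upper bound
  \<open>M\<close> lets the supremum be used without a maximising flow.\<close>

lemma dir_expansion_le_objective:
  assumes v: "sdp_feasible n vw v"
    and M: "\<And>F. F \<in> flows n E Hd Tl w \<Longrightarrow> sdp_objective n F v \<le> M"
  shows "dir_expansion n E Hd Tl w vw \<le> 2 ^ 39 * sqrt (ln n) * M"
proof -
  have pos: "\<And>i. i < n \<Longrightarrow> vw i > 0" using wf by (simp add: dhg_wf_def)
  interpret weighted_neg_type "{..<n}" "{..<n}" v vw
  proof
    show "card {..<n} \<ge> 2" using n by simp
  qed (use v pos in \<open>auto simp: sdp_feasible_def sqdist_def\<close>)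
  have D: "D i j = sqdist n (v i) (v j)" for i j by (simp add: D_def sqdist_def)
  \<comment> \<open>Centring removes the cross terms, so the sum is the total weight times the
    squared norm of \<open>v i\<close>, plus 1.\<close>
  have avg: "(\<Sum>j<n. vw j * D i j) \<ge> 1" for i
  proof -
    have "(\<Sum>j<n. vw j * D i j) = (\<Sum>j<n. \<Sum>k<n. vw j * (v i k)\<^sup>2 - 2 * v i k * (vw j * v j k) + vw j * (v j k)\<^sup>2)"
      unfolding D_def sum_distrib_left by (intro sum.cong refl) (simp add: power2_eq_square algebra_simps)
    also have "\<dots> = (\<Sum>j<n. \<Sum>k<n. vw j * (v i k)\<^sup>2) - (\<Sum>j<n. \<Sum>k<n. 2 * v i k * (vw j * v j k))
        + (\<Sum>j<n. vw j * (\<Sum>k<n. (v j k)\<^sup>2))"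
      by (simp only: sum.distrib sum_subtractf sum_distrib_left)
    also have "(\<Sum>j<n. \<Sum>k<n. 2 * v i k * (vw j * v j k)) = (\<Sum>k<n. 2 * v i k * (\<Sum>j<n. vw j * v j k))"
      unfolding sum_distrib_left by (rule sum.swap)
    also have "\<dots> = 0" using v by (intro sum.neutral) (simp add: sdp_feasible_def)
    also have "(\<Sum>j<n. vw j * (\<Sum>k<n. (v j k)\<^sup>2)) = 1" using v by (simp add: sdp_feasible_def)
    finally have "(\<Sum>j<n. vw j * D i j) = (\<Sum>j<n. \<Sum>k<n. vw j * (v i k)\<^sup>2) + 1" by simp
    moreover have "(\<Sum>j<n. \<Sum>k<n. vw j * (v i k)\<^sup>2) \<ge> 0"
      using pos by (intro sum_nonneg mult_nonneg_nonneg) (auto intro: less_imp_le)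
    ultimately show ?thesis by linarith
  qed
  obtain \<rho> q where q: "\<And>e. e \<in> E \<Longrightarrow> q e \<ge> 0" "(\<Sum>e\<in>E. w e * q e) \<le> M"
    "\<And>e i j. e \<in> E \<Longrightarrow> i \<in> Hd e \<Longrightarrow> j \<in> Tl e \<Longrightarrow> D i j / 2 + \<rho> j - \<rho> i \<le> q e"
    unfolding D using flow_duality[OF wf M] by blast
  obtain Z f where Z: "Z \<subseteq> {..<n}" "sum vw Z \<ge> W / 128" and f: "\<And>i. f i \<ge> 0" "\<And>i. i \<in> Z \<Longrightarrow> f i = 0"
    and total: "(\<Sum>i<n. vw i * f i) \<ge> 1 / (2 ^ 32 * sqrt (ln n))"
    and step: "(\<forall>i<n. \<forall>j<n. f i \<le> f j + max 0 (D i j / 2 + \<rho> j - \<rho> i))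
      \<or> (\<forall>i<n. \<forall>j<n. f j \<le> f i + max 0 (D i j / 2 + \<rho> j - \<rho> i))"
    using potential_function[OF avg, of \<rho>] by (auto simp: Ball_def)
  have edge: "max 0 (D i j / 2 + \<rho> j - \<rho> i) \<le> q e" if "e \<in> E" "i \<in> Hd e" "j \<in> Tl e" for e i j
    using q(1)[OF that(1)] q(3)[OF that] by simp
  have lt: "i < n" "j < n" if "e \<in> E" "i \<in> Hd e" "j \<in> Tl e" for e i j
    using wf that by (auto simp: dhg_wf_def)
  have "dir_expansion n E Hd Tl w vw * (1 / 128) * (\<Sum>i<n. vw i * f i) \<le> (\<Sum>e\<in>E. w e * q e)"
  proof (rule threshold_rounding[OF Z(1) _ _ _ f q(1)])
    show "1 / 128 * sum vw {..<n} \<le> sum vw Z" using Z(2) by (simp add: W_def)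
    show "(\<forall>e\<in>E. \<forall>i\<in>Hd e. \<forall>j\<in>Tl e. f i \<le> f j + q e) \<or> (\<forall>e\<in>E. \<forall>i\<in>Hd e. \<forall>j\<in>Tl e. f j \<le> f i + q e)"
      using step
    proof (elim disjE)
      assume *: "\<forall>i<n. \<forall>j<n. f i \<le> f j + max 0 (D i j / 2 + \<rho> j - \<rho> i)"
      have "f i \<le> f j + q e" if "e \<in> E" "i \<in> Hd e" "j \<in> Tl e" for e i j
        using *[rule_format, OF lt[OF that]] edge[OF that] by linarith
      then show ?thesis by blast
    next
      assume *: "\<forall>i<n. \<forall>j<n. f j \<le> f i + max 0 (D i j / 2 + \<rho> j - \<rho> i)"
      have "f j \<le> f i + q e" if "e \<in> E" "i \<in> Hd e" "j \<in> Tl e" for e i j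
        using *[rule_format, OF lt[OF that]] edge[OF that] by linarith
      then show ?thesis by blast
    qed
  qed auto
  moreover have "dir_expansion n E Hd Tl w vw * (1 / 128) * (1 / (2 ^ 32 * sqrt (ln n)))
      \<le> dir_expansion n E Hd Tl w vw * (1 / 128) * (\<Sum>i<n. vw i * f i)"
    using total dir_expansion_nonneg by (intro mult_left_mono) auto
  ultimately have "dir_expansion n E Hd Tl w vw * (1 / 128) * (1 / (2 ^ 32 * sqrt (ln n))) \<le> M"
    using q(2) by linarith
  moreover have "sqrt (ln n) > 0" using n by simp
  ultimately show ?thesis by (simp add: field_simps)
qed

section \<open>Cut vectors and the two bounds\<close>

text \<open>The factor 2 compares the squared distance \<open>(s + t) / (s * t)\<close> between the
  two sides with \<open>1 / min s t\<close>.\<close>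

lemma cut_vectors:
  assumes S: "S \<noteq> {}" "S \<subset> {..<n}"
  shows "\<exists>v. sdp_feasible n vw v
    \<and> (\<forall>F\<in>flows n E Hd Tl w. sdp_objective n F v \<le> 2 * dir_expansion_set n E Hd Tl w vw S)"
proof -
  define s where "s = sum vw S"
  define t where "t = sum vw ({..<n} - S)"
  have s: "s > 0" and t: "t > 0" using S by (auto simp: s_def t_def intro!: sum_weights_pos)
  have E: "finite E" and sub: "\<And>e. e \<in> E \<Longrightarrow> Hd e \<subseteq> {..<n} \<and> Tl e \<subseteq> {..<n}"
    using wf by (auto simp: dhg_wf_def)
  \<comment> \<open>Values proportional to \<open>t\<close> on \<open>S\<close> and
    \<open>- s\<close> off \<open>S\<close> are centred, and their weighted square sum is
    \<open>s * t\<^sup>2 + t * s\<^sup>2\<close>, the square of \<open>r\<close>. They are embedded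
    in coordinate 0.\<close>
  define r where "r = sqrt (s * t * (s + t))"
  have r: "r > 0" "r\<^sup>2 = s * t * (s + t)" using s t by (auto simp: r_def)
  define y where "y = (\<lambda>i. if i \<in> S then t / r else - s / r)"
  define v where "v = (\<lambda>i k. if k = (0::nat) then y i else 0)"
  have sum0: "(\<Sum>k<n. g k) = g 0" if "\<And>k. k \<noteq> 0 \<Longrightarrow> g k = 0" for g :: "nat \<Rightarrow> real"
    using n that by (subst sum.remove[of _ 0]) (auto intro!: sum.neutral)
  have dist: "sqdist n (v i) (v j) = (s + t) / (s * t) * (of_bool (i \<in> S \<and> j \<notin> S) + of_bool (i \<notin> S \<and> j \<in> S))" for i j
  proof -
    have 1: "(t / r + s / r)\<^sup>2 = (s + t) / (s * t)"
      using s t unfolding add_divide_distrib[symmetric] power_divide r(2)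
      unfolding power2_eq_square add.commute[of t s] by simp
    have "(- s / r - t / r)\<^sup>2 = (t / r + s / r)\<^sup>2"
      by (simp add: power2_eq_square algebra_simps)
    then have 2: "(- s / r - t / r)\<^sup>2 = (s + t) / (s * t)" using 1 by simp
    have "sqdist n (v i) (v j) = (y i - y j)\<^sup>2"
      unfolding sqdist_def by (subst sum0) (auto simp: v_def)
    then show ?thesis using 1 2 by (simp add: y_def)
  qed
  have split: "(\<Sum>i<n. vw i * g i) = s * a + t * b"
    if "\<And>i. i \<in> S \<Longrightarrow> g i = a" "\<And>i. i \<notin> S \<Longrightarrow> g i = b" for g :: "nat \<Rightarrow> real" and a b
  proof -
    have "(\<Sum>i<n. vw i * g i) = (\<Sum>i\<in>{..<n} - S. vw i * g i) + (\<Sum>i\<in>S. vw i * g i)"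
      using S by (intro sum.subset_diff) auto
    then show ?thesis using that by (simp add: s_def t_def sum_distrib_right)
  qed
  have feasible: "sdp_feasible n vw v"
    unfolding sdp_feasible_def
  proof (intro conjI allI impI)
    fix k
    have "(\<Sum>i<n. vw i * y i) = s * (t / r) + t * (- s / r)" by (rule split) (auto simp: y_def)
    then show "(\<Sum>i<n. vw i * v i k) = 0" by (cases "k = 0") (auto simp: v_def)
  next
    have "(\<Sum>i<n. vw i * (\<Sum>k<n. (v i k)\<^sup>2)) = (\<Sum>i<n. vw i * (y i)\<^sup>2)"
      by (subst sum0) (auto simp: v_def)
    also have "\<dots> = s * (t / r)\<^sup>2 + t * (- s / r)\<^sup>2" by (rule split) (auto simp: y_def)
    also have "\<dots> = t / (s + t) + s / (s + t)"
      using s t unfolding power_divide r(2) power2_minus unfolding power2_eq_square by simp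
    also have "\<dots> = 1" using s t unfolding add_divide_distrib[symmetric] by simp
    finally show "(\<Sum>i<n. vw i * (\<Sum>k<n. (v i k)\<^sup>2)) = 1" .
  next
    fix i j k
    show "sqdist n (v i) (v k) \<le> sqdist n (v i) (v j) + sqdist n (v j) (v k)"
      unfolding dist distrib_left[symmetric] using s t by (intro mult_left_mono) auto
  qed
  have "sdp_objective n F v \<le> 2 * dir_expansion_set n E Hd Tl w vw S" if F: "F \<in> flows n E Hd Tl w" for F
  proof -
    obtain Fe where Fe: "\<forall>e\<in>E. \<forall>i\<in>Hd e. \<forall>j\<in>Tl e. Fe e i j \<ge> 0"
      "\<forall>e\<in>E. (\<Sum>i\<in>Hd e. \<Sum>j\<in>Tl e. Fe e i j) \<le> w e"
      "F = (\<lambda>i j. \<Sum>e\<in>{e\<in>E. i \<in> Hd e \<and> j \<in> Tl e}. Fe e i j)"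
      "\<forall>j<n. (\<Sum>i<n. F i j) = (\<Sum>k<n. F j k)"
      using F unfolding flows_def by blast
    \<comment> \<open>The first argument of \<open>F\<close> is the head and the second the tail, so
      this is the flow leaving \<open>X\<close>.\<close>
    define across where "across = (\<lambda>X. \<Sum>i<n. \<Sum>j<n. F i j * of_bool (i \<notin> X \<and> j \<in> X))"
    have cap: "across X \<le> sum w (delta_out n E Hd Tl X)" for X
    proof -
      have "across X = (\<Sum>e\<in>E. \<Sum>i\<in>Hd e. \<Sum>j\<in>Tl e. Fe e i j * of_bool (i \<notin> X \<and> j \<in> X))"
        unfolding across_def Fe(3) by (rule sum_pairs_edges[OF E sub])
      also have "\<dots> \<le> (\<Sum>e\<in>E. if e \<in> delta_out n E Hd Tl X then w e else 0)"
      proof (intro sum_mono)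
        fix e assume e: "e \<in> E"
        show "(\<Sum>i\<in>Hd e. \<Sum>j\<in>Tl e. Fe e i j * of_bool (i \<notin> X \<and> j \<in> X))
            \<le> (if e \<in> delta_out n E Hd Tl X then w e else 0)"
        proof (cases "e \<in> delta_out n E Hd Tl X")
          case True
          have "(\<Sum>i\<in>Hd e. \<Sum>j\<in>Tl e. Fe e i j * of_bool (i \<notin> X \<and> j \<in> X)) \<le> (\<Sum>i\<in>Hd e. \<Sum>j\<in>Tl e. Fe e i j)"
            using Fe(1) e by (intro sum_mono) auto
          then show ?thesis using Fe(2) e True by auto
        next
          case False
          then have zero: "Fe e i j * of_bool (i \<notin> X \<and> j \<in> X) = 0" if "i \<in> Hd e" "j \<in> Tl e" for i j
            using that e sub[OF e] by (auto simp: delta_out_def)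
          have "(\<Sum>i\<in>Hd e. \<Sum>j\<in>Tl e. Fe e i j * of_bool (i \<notin> X \<and> j \<in> X)) = 0"
            by (intro sum.neutral ballI zero)
          then show ?thesis using False by simp
        qed
      qed
      also have "\<dots> = sum w (delta_out n E Hd Tl X)"
        using E by (simp add: delta_out_def sum.inter_filter)
      finally show ?thesis .
    qed
    have eq: "across ({..<n} - S) = across S"
    proof -
      have "(\<Sum>j\<in>S. \<Sum>i<n. F i j) = (\<Sum>j\<in>S. \<Sum>k<n. F j k)"
      proof (rule sum.cong[OF refl])
        fix j assume "j \<in> S"
        then have "j < n" using S by auto
        then show "(\<Sum>i<n. F i j) = (\<Sum>k<n. F j k)" using Fe(4) by simp
      qed
      moreover have ind: "sum g S = (\<Sum>j<n. g j * of_bool (j \<in> S))" for g :: "nat \<Rightarrow> real"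
        using S by (intro sum.mono_neutral_cong_left) auto
      have "(\<Sum>j\<in>S. \<Sum>i<n. F i j) = (\<Sum>i<n. \<Sum>j<n. F i j * of_bool (j \<in> S))"
        unfolding ind sum_distrib_right by (rule sum.swap)
      moreover have "(\<Sum>j\<in>S. \<Sum>k<n. F j k) = (\<Sum>i<n. \<Sum>j<n. F i j * of_bool (i \<in> S))"
        unfolding ind sum_distrib_right ..
      moreover have "across S - across ({..<n} - S)
          = (\<Sum>i<n. \<Sum>j<n. F i j * of_bool (j \<in> S)) - (\<Sum>i<n. \<Sum>j<n. F i j * of_bool (i \<in> S))"
        unfolding across_def sum_subtractf[symmetric] by (intro sum.cong refl) auto
      ultimately show ?thesis by simp
    qed
    have "sdp_objective n F v = (s + t) / (s * t) * (across ({..<n} - S) + across S) / 2"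
      unfolding sdp_objective_eq dist across_def sum.distrib[symmetric] sum_distrib_left
      by (intro arg_cong2[where f = "(/)"] sum.cong refl) (auto simp: algebra_simps)
    also have "\<dots> = (s + t) / (s * t) * across S" using eq by simp
    also have "\<dots> \<le> 2 / min s t * min (sum w (delta_out n E Hd Tl S)) (sum w (delta_out n E Hd Tl ({..<n} - S)))"
    proof (intro mult_mono)
      show "(s + t) / (s * t) \<le> 2 / min s t"
        using s t by (simp add: min_def field_simps)
      show "across S \<le> min (sum w (delta_out n E Hd Tl S)) (sum w (delta_out n E Hd Tl ({..<n} - S)))"
        using cap[of S] cap[of "{..<n} - S"] eq by simp
      show "0 \<le> across S"
        unfolding across_def Fe(3) using Fe(1) by (auto intro!: sum_nonneg mult_nonneg_nonneg)
      show "0 \<le> 2 / min s t" using s t by simp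
    qed
    finally show ?thesis by (simp add: dir_expansion_set_def s_def t_def)
  qed
  then show ?thesis using feasible by blast
qed

text \<open>Bounds the infimum over feasible vectors from below, so that a single feasible solution
  bounds \<open>lambda_tri\<close> from above.\<close>

lemma objective_Sup_nonneg: "(SUP F\<in>flows n E Hd Tl w. sdp_objective n F v) \<ge> 0"
proof (rule cSUP_upper2[OF objective_bdd_above[OF wf] zero_flow[OF wf]])
  show "0 \<le> sdp_objective n (\<lambda>_ _. 0) v" by (simp add: sdp_objective_def)
qed

lemma lambda_tri_le_dir_expansion: "lambda_tri n E Hd Tl w vw \<le> 2 * dir_expansion n E Hd Tl w vw"
proof -
  obtain S where S: "S \<noteq> {}" "S \<subset> {..<n}"
    "dir_expansion n E Hd Tl w vw = dir_expansion_set n E Hd Tl w vw S"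
    using dir_expansion_attained by blast
  obtain v where v: "sdp_feasible n vw v"
    "\<And>F. F \<in> flows n E Hd Tl w \<Longrightarrow> sdp_objective n F v \<le> 2 * dir_expansion_set n E Hd Tl w vw S"
    using cut_vectors[OF S(1,2)] by blast
  have "(SUP F\<in>flows n E Hd Tl w. sdp_objective n F v) \<le> 2 * dir_expansion_set n E Hd Tl w vw S"
    using v(2) zero_flow[OF wf] by (intro cSUP_least) auto
  moreover have "lambda_tri n E Hd Tl w vw \<le> (SUP F\<in>flows n E Hd Tl w. sdp_objective n F v)"
    unfolding lambda_tri_def using v(1)
    by (intro cINF_lower bdd_belowI2[of _ 0] objective_Sup_nonneg) auto
  ultimately show ?thesis using S(3) by simp
qed

lemma dir_expansion_le_lambda_tri:
  "dir_expansion n E Hd Tl w vw \<le> 2 ^ 39 * sqrt (ln n) * lambda_tri n E Hd Tl w vw"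
proof -
  have pos: "2 ^ 39 * sqrt (ln n) > 0" using n by simp
  have "dir_expansion n E Hd Tl w vw / (2 ^ 39 * sqrt (ln n)) \<le> lambda_tri n E Hd Tl w vw"
    unfolding lambda_tri_def
  proof (rule cINF_greatest)
    \<comment> \<open>The vectors of any cut are feasible, so the infimum is not taken over the
      empty set.\<close>
    show "{v. sdp_feasible n vw v} \<noteq> {}"
      using cut_vectors dir_expansion_attained by blast
    fix v assume "v \<in> {v. sdp_feasible n vw v}"
    then have "dir_expansion n E Hd Tl w vw
        \<le> 2 ^ 39 * sqrt (ln n) * (SUP F\<in>flows n E Hd Tl w. sdp_objective n F v)"
      using cSUP_upper[OF _ objective_bdd_above[OF wf, of v]] by (intro dir_expansion_le_objective) auto
    then show "dir_expansion n E Hd Tl w vw / (2 ^ 39 * sqrt (ln n))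
        \<le> (SUP F\<in>flows n E Hd Tl w. sdp_objective n F v)"
      using pos by (simp only: pos_divide_le_eq mult.commute)
  qed
  then show ?thesis using pos by (simp only: pos_divide_le_eq mult.commute)
qed

end

theorem mainTheorem19:
  "\<exists>C1 C2 :: real. C1 > 0 \<and> C2 > 0 \<and>
    (\<forall>(n::nat) E Hd Tl w vw. n \<ge> 2 \<and> dhg_wf n E Hd Tl w vw \<longrightarrow>
       lambda_tri n E Hd Tl w vw \<le> C1 * dir_expansion n E Hd Tl w vw \<and>
       dir_expansion n E Hd Tl w vw \<le> C2 * sqrt (ln (real n)) * lambda_tri n E Hd Tl w vw)"
proof (intro exI conjI allI impI)
  fix n :: nat and E Hd Tl and w vw :: "nat \<Rightarrow> real"
  assume *: "n \<ge> 2 \<and> dhg_wf n E Hd Tl w vw"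
  show "lambda_tri n E Hd Tl w vw \<le> 2 * dir_expansion n E Hd Tl w vw"
    using * by (intro lambda_tri_le_dir_expansion) auto
  show "dir_expansion n E Hd Tl w vw \<le> 2 ^ 39 * sqrt (ln (real n)) * lambda_tri n E Hd Tl w vw"
    using * by (intro dir_expansion_le_lambda_tri) auto
qed simp_all

end
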